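(* Let $n,k\ge1$ be integers, $E$ a finite-dimensional real inner product space, and $\gamma\in(0,\min\{n,2/k\})$. Let $X$ be a centred, stationary $E$-valued Gaussian random field on $\mathbb{T}^n$ whose covariance is represented by an integrable kernel $C$ on $\mathbb{T}^n$, i.e. $\mathrm{Cov}(\langle X,\phi\rangle,\langle X,\psi\rangle)=\langle\phi,C*\psi\rangle$ for all $\phi,\psi\in C^\infty(\mathbb{T}^n;E)$, such that $C(x)=C(-x)$ and $$\sup_{x\in\mathbb{T}^n\setminus\{0\}}|x|^\gamma|C(x)|<\infty.$$ Let $F(x,y)=\sum_{i=0}^kQ_i(x,y)+\sum_{j=0}^{2k+1}P_j(x)$ be as described in the context, and $F_{\mathrm{crit}}(x,y)=Q_k(x,y)+P_{2k+1}(x)$. Then: (a) there exists $q_*\in(nk,\infty)$ such that $X$ satisfies the spectral gap inequality with $L^{q^*}$-norm, where $\frac1{q_*}+\frac1{q^*}=1$; (b) $X$ and $\tau_aX$ are equal in law for every $a\in\mathbb{T}^n$; (c) if $F_{\mathrm{crit}}\not\equiv0$, then there exists $\sigma\in\{0,1\}$ such that $\mathcal{R}^\sigma X$ and $-X$ are equal in law, and such that $\sigma\equiv k\pmod 2$ whenever $Q_k\not\equiv0$.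
   Context: $\mathbb{T}^n=\mathbb{R}^n/\mathbb{Z}^n$; $|x|$ for $x\in\mathbb{T}^n$ is the geodesic distance from $0$. A random field is a random element of $\mathcal{D}'(\mathbb{T}^n;E)$; it is stationary if its law is invariant under all translations. $C$ takes values in the linear maps $E\to E$ (a scalar kernel being identified with a multiple of the identity), $|C(x)|$ is the operator norm, and $(C*\psi)(x)=\int_{\mathbb{T}^n}C(x-y)\psi(y)\,dy$. Operators (by duality): $\tau_a\phi(x)=\phi(x-a)$, $\mathcal{R}\phi(x)=\phi(-x)$, $\mathcal{R}^0=\mathrm{Id}$, $\mathcal{R}^1=\mathcal{R}$. Non-linearity. $Q_i\colon E^i\times E^n\to E$ is $(i+1)$-linear, symmetric in its first $i$ arguments ($0\le i\le k$); $P_j\colon E^j\to E$ is $j$-linear and symmetric ($0\le j\le 2k+1$); $E^0=\{0\}$, so $Q_0$ is linear on $E^n$ and $P_0\in E$ is constant; $Q_i(x,y)=Q_i(x,\dots,x,y)$, $P_j(x)=P_j(x,\dots,x)$. Spectral gap inequality. Write $\mathcal{D}(\mathbb{T}^n;E)=C^\infty(\mathbb{T}^n;E)$. $G\colon\mathcal{D}'(\mathbb{T}^n;E)\to\mathbb{R}$ is cylindrical if $G(\xi)=f(\xi(\phi_1),\dots,\xi(\phi_m))$ with $m\in\mathbb{N}$, $\phi_i\in\mathcal{D}(\mathbb{T}^n;E)$, $f\colon\mathbb{R}^m\to\mathbb{R}$ smooth; $\frac{\delta G}{\delta\xi}=\sum_i\partial_if(\xi(\phi_1),\dots,\xi(\phi_m))\phi_i$.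 A random distribution $\xi$ satisfies the spectral gap inequality with norm $\|\cdot\|$ on $\mathcal{D}(\mathbb{T}^n;E)$ if there is a constant $K$ such that for all bounded cylindrical $G$, $(\mathbb{E}|G(\xi)|^2)^{1/2}\le K\big(|\mathbb{E}[G(\xi)]|+(\mathbb{E}\|\frac{\delta G}{\delta\xi}\|^2)^{1/2}\big)$. "With $L^{q^*}$-norm" means $\|\cdot\|$ is the $L^{q^*}(\mathbb{T}^n;E)$-norm. *)

theory Defs
  imports "HOL-Probability.Probability"
begin

text \<open>
  The torus \<open>\<real>\<^sup>n / \<int>\<^sup>n\<close> with \<open>n = CARD('n)\<close> is handled through representatives in
  \<^typ>\<open>real^'n\<close>: functions on the torus are \<open>\<int>\<^sup>n\<close>-periodic functions, the normalised Haar
  measure is Lebesgue measure on the half-open unit cube, and the geodesic distance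
  from \<open>x\<close> to \<open>0\<close> is the Euclidean distance from \<open>x\<close> to the lattice.
\<close>

definition int_lattice :: "(real^'n) set" where
  "int_lattice = {z. \<forall>i. z $ i \<in> \<int>}"

definition periodic :: "(real^'n \<Rightarrow> 'b) \<Rightarrow> bool" where
  "periodic f \<longleftrightarrow> (\<forall>x. \<forall>z\<in>int_lattice. f (x + z) = f x)"

definition torus :: "(real^'n) measure" where
  "torus = restrict_space lborel {x. \<forall>i. 0 \<le> x $ i \<and> x $ i < 1}"

definition torus_abs :: "real^'n \<Rightarrow> real" where
  "torus_abs x = infdist x int_lattice"

definition Lp_norm :: "real \<Rightarrow> (real^'n \<Rightarrow> 'e::euclidean_space) \<Rightarrow> real" where
  "Lp_norm p \<phi> = (LINT x|torus. norm (\<phi> x) powr p) powr (1 / p)"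


subsection \<open>Test functions\<close>

definition partial :: "'n \<Rightarrow> (real^'n \<Rightarrow> 'e) \<Rightarrow> real^'n \<Rightarrow> 'e::real_normed_vector" where
  "partial i f x = vector_derivative (\<lambda>t. f (x + t *\<^sub>R axis i 1)) (at 0)"

definition partials :: "'n list \<Rightarrow> (real^'n \<Rightarrow> 'e) \<Rightarrow> real^'n \<Rightarrow> 'e::real_normed_vector" where
  "partials is f = foldr partial is f"

text \<open>A function is smooth iff all iterated partial derivatives exist and are continuous.\<close>

definition smooth :: "(real^'n \<Rightarrow> 'e::real_normed_vector) \<Rightarrow> bool" where
  "smooth f \<longleftrightarrow>
    (\<forall>is. continuous_on UNIV (partials is f) \<and>
      (\<forall>i x. (\<lambda>t. partials is f (x + t *\<^sub>R axis i 1)) differentiable (at 0)))"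

definition test_funs :: "(real^'n \<Rightarrow> 'e::euclidean_space) set" where
  "test_funs = {\<phi>. periodic \<phi> \<and> smooth \<phi>}"

definition CN_norm :: "nat \<Rightarrow> (real^'n \<Rightarrow> 'e::euclidean_space) \<Rightarrow> real" where
  "CN_norm N \<phi> = (SUP (is, x) \<in> {is. length is \<le> N} \<times> UNIV. norm (partials is \<phi> x))"


subsection \<open>Distributions\<close>

text \<open>
  Distributions are the continuous linear functionals on the Frechet space of test
  functions.  They are extensional, so that equality of distributions is equality of
  functions.  The space of distributions carries the sigma-algebra generated by the
  evaluations \<open>T \<mapsto> T \<phi>\<close>.
\<close>

type_synonym ('n, 'e) functional = "(real^'n \<Rightarrow> 'e) \<Rightarrow> real"

definition distributions :: "('n::finite, 'e::euclidean_space) functional set" where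
  "distributions = {T \<in> extensional test_funs.
     (\<forall>\<phi>\<in>test_funs. \<forall>\<psi>\<in>test_funs. T (\<lambda>x. \<phi> x + \<psi> x) = T \<phi> + T \<psi>) \<and>
     (\<forall>\<phi>\<in>test_funs. \<forall>c. T (\<lambda>x. c *\<^sub>R \<phi> x) = c * T \<phi>) \<and>
     (\<exists>N B. \<forall>\<phi>\<in>test_funs. \<bar>T \<phi>\<bar> \<le> B * CN_norm N \<phi>)}"

definition distr_space :: "('n::finite, 'e::euclidean_space) functional measure" where
  "distr_space = restrict_space (\<Pi>\<^sub>M \<phi>\<in>test_funs. borel) distributions"

text \<open>
  Since \<open>\<langle>\<tau>\<^sub>a T, \<phi>\<rangle> = \<langle>T, \<tau>\<^sub>-\<^sub>a \<phi>\<rangle>\<close>, the shift of the test function has the opposite sign.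
\<close>

definition translate :: "real^'n \<Rightarrow> ('n, 'e) functional \<Rightarrow> ('n::finite, 'e::euclidean_space) functional" where
  "translate a T = (\<lambda>\<phi>\<in>test_funs. T (\<lambda>x. \<phi> (x + a)))"

definition reflect :: "('n, 'e) functional \<Rightarrow> ('n::finite, 'e::euclidean_space) functional" where
  "reflect T = (\<lambda>\<phi>\<in>test_funs. T (\<lambda>x. \<phi> (- x)))"

definition negate :: "('n, 'e) functional \<Rightarrow> ('n::finite, 'e::euclidean_space) functional" where
  "negate T = (\<lambda>\<phi>\<in>test_funs. - T \<phi>)"


subsection \<open>Random fields\<close>

definition random_field :: "'w measure \<Rightarrow> ('w \<Rightarrow> ('n::finite, 'e::euclidean_space) functional) \<Rightarrow> bool" where
  "random_field M X \<longleftrightarrow> prob_space M \<and> X \<in> M \<rightarrow>\<^sub>M distr_space"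

definition law :: "'w measure \<Rightarrow> ('w \<Rightarrow> ('n::finite, 'e::euclidean_space) functional)
    \<Rightarrow> ('n, 'e) functional measure" where
  "law M X = distr M distr_space X"

definition stationary :: "'w measure \<Rightarrow> ('w \<Rightarrow> ('n::finite, 'e::euclidean_space) functional) \<Rightarrow> bool" where
  "stationary M X \<longleftrightarrow> (\<forall>a. law M (\<lambda>\<omega>. translate a (X \<omega>)) = law M X)"

definition centred :: "'w measure \<Rightarrow> ('w \<Rightarrow> ('n::finite, 'e::euclidean_space) functional) \<Rightarrow> bool" where
  "centred M X \<longleftrightarrow> (\<forall>\<phi>\<in>test_funs. (LINT \<omega>|M. X \<omega> \<phi>) = 0)"

text \<open>Point masses are Gaussian.\<close>

definition gaussian_measure :: "real measure \<Rightarrow> bool" where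
  "gaussian_measure \<mu> \<longleftrightarrow>
    (\<exists>m. \<mu> = return borel m) \<or>
    (\<exists>m s. 0 < s \<and> \<mu> = density lborel (\<lambda>x. ennreal (normal_density m s x)))"

text \<open>
  By linearity of \<open>X \<omega>\<close>, this makes all finite families of evaluations jointly Gaussian.
\<close>

definition gaussian_field :: "'w measure \<Rightarrow> ('w \<Rightarrow> ('n::finite, 'e::euclidean_space) functional) \<Rightarrow> bool" where
  "gaussian_field M X \<longleftrightarrow> (\<forall>\<phi>\<in>test_funs. gaussian_measure (distr M borel (\<lambda>\<omega>. X \<omega> \<phi>)))"

definition covariance :: "'w measure \<Rightarrow> ('w \<Rightarrow> real) \<Rightarrow> ('w \<Rightarrow> real) \<Rightarrow> real" where
  "covariance M U V = (LINT \<omega>|M. (U \<omega> - (LINT \<omega>'|M. U \<omega>')) * (V \<omega> - (LINT \<omega>'|M. V \<omega>')))"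

text \<open>
  Integrability of an operator-valued kernel is stated strongly, that is, for each
  \<open>x \<mapsto> C x v\<close>: the library has no Bochner integral for \<^typ>\<open>'e \<Rightarrow>\<^sub>L 'e\<close>, and for
  finite-dimensional \<^typ>\<open>'e\<close> this is the same notion.
\<close>

definition integrable_kernel :: "(real^'n \<Rightarrow> 'e::euclidean_space \<Rightarrow>\<^sub>L 'e) \<Rightarrow> bool" where
  "integrable_kernel C \<longleftrightarrow> periodic C \<and> (\<forall>v. integrable torus (\<lambda>x. blinfun_apply (C x) v))"

definition convolve :: "(real^'n \<Rightarrow> 'e::euclidean_space \<Rightarrow>\<^sub>L 'e) \<Rightarrow> (real^'n \<Rightarrow> 'e) \<Rightarrow> real^'n \<Rightarrow> 'e" where
  "convolve C \<psi> x = (LINT y|torus. blinfun_apply (C (x - y)) (\<psi> y))"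

definition covariance_kernel :: "'w measure \<Rightarrow> ('w \<Rightarrow> ('n::finite, 'e::euclidean_space) functional)
    \<Rightarrow> (real^'n \<Rightarrow> 'e \<Rightarrow>\<^sub>L 'e) \<Rightarrow> bool" where
  "covariance_kernel M X C \<longleftrightarrow>
    (\<forall>\<phi>\<in>test_funs. \<forall>\<psi>\<in>test_funs.
      covariance M (\<lambda>\<omega>. X \<omega> \<phi>) (\<lambda>\<omega>. X \<omega> \<psi>) = (LINT x|torus. \<phi> x \<bullet> convolve C \<psi> x))"


subsection \<open>Spectral gap inequality\<close>

text \<open>
  As \<open>m\<close> varies inside the definition of cylindrical functionals, a function on \<open>\<real>\<^sup>m\<close> is
  represented as a function of a sequence that depends on the first \<open>m\<close> entries only;
  continuity for the product topology then is continuity on \<open>\<real>\<^sup>m\<close>.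
\<close>

definition pderiv_seq :: "nat \<Rightarrow> ((nat \<Rightarrow> real) \<Rightarrow> real) \<Rightarrow> (nat \<Rightarrow> real) \<Rightarrow> real" where
  "pderiv_seq i f x = deriv (\<lambda>t. f (x(i := t))) (x i)"

definition smooth_seq :: "nat \<Rightarrow> ((nat \<Rightarrow> real) \<Rightarrow> real) \<Rightarrow> bool" where
  "smooth_seq m f \<longleftrightarrow>
    (\<forall>x y. (\<forall>i<m. x i = y i) \<longrightarrow> f x = f y) \<and>
    (\<forall>is. set is \<subseteq> {..<m} \<longrightarrow>
      continuous_on UNIV (foldr pderiv_seq is f) \<and>
      (\<forall>i<m. \<forall>x. (\<lambda>t. foldr pderiv_seq is f (x(i := t))) differentiable (at (x i))))"

definition cyl :: "((nat \<Rightarrow> real) \<Rightarrow> real) \<Rightarrow> (nat \<Rightarrow> real^'n \<Rightarrow> 'e) \<Rightarrow>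
    ('n::finite, 'e::euclidean_space) functional \<Rightarrow> real" where
  "cyl f \<phi> T = f (\<lambda>i. T (\<phi> i))"

definition cyl_deriv :: "nat \<Rightarrow> ((nat \<Rightarrow> real) \<Rightarrow> real) \<Rightarrow> (nat \<Rightarrow> real^'n \<Rightarrow> 'e) \<Rightarrow>
    ('n::finite, 'e::euclidean_space) functional \<Rightarrow> real^'n \<Rightarrow> 'e" where
  "cyl_deriv m f \<phi> T = (\<lambda>x. \<Sum>i<m. pderiv_seq i f (\<lambda>j. T (\<phi> j)) *\<^sub>R \<phi> i x)"

text \<open>
  Only \<open>G = cyl f \<phi>\<close> is assumed bounded, so \<open>E \<parallel>\<delta>G/\<delta>\<xi>\<parallel>\<^sup>2\<close> may be infinite, in which case
  the inequality is void; this is the integrability premise.  (The case \<open>G = 1\<close> forces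
  \<open>K \<ge> 1\<close>.)
\<close>

definition spectral_gap :: "'w measure \<Rightarrow> ('w \<Rightarrow> ('n::finite, 'e::euclidean_space) functional)
    \<Rightarrow> ((real^'n \<Rightarrow> 'e) \<Rightarrow> real) \<Rightarrow> bool" where
  "spectral_gap M \<xi> nrm \<longleftrightarrow>
    (\<exists>K. \<forall>m f \<phi>.
      (\<forall>i<m. \<phi> i \<in> test_funs) \<longrightarrow> smooth_seq m f \<longrightarrow>
      (\<exists>b. \<forall>T\<in>distributions. \<bar>cyl f \<phi> T\<bar> \<le> b) \<longrightarrow>
      integrable M (\<lambda>\<omega>. (nrm (cyl_deriv m f \<phi> (\<xi> \<omega>)))\<^sup>2) \<longrightarrow>
      sqrt (LINT \<omega>|M. \<bar>cyl f \<phi> (\<xi> \<omega>)\<bar>\<^sup>2)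
        \<le> K * (\<bar>LINT \<omega>|M. cyl f \<phi> (\<xi> \<omega>)\<bar>
                + sqrt (LINT \<omega>|M. (nrm (cyl_deriv m f \<phi> (\<xi> \<omega>)))\<^sup>2)))"


subsection \<open>The non-linearity\<close>

text \<open>
  The first \<open>i\<close> arguments of \<open>Q\<^sub>i\<close> and the arguments of \<open>P\<^sub>j\<close> are passed as a list of
  the respective length; values at lists of other lengths are irrelevant.  Lists with the
  same multiset of entries are permutations of each other.
\<close>

definition multilinear_sym :: "nat \<Rightarrow> ('e list \<Rightarrow> 'e::euclidean_space) \<Rightarrow> bool" where
  "multilinear_sym j P \<longleftrightarrow>
    (\<forall>xs. length xs = j \<longrightarrow> (\<forall>l<j. linear (\<lambda>v. P (xs[l := v])))) \<and>
    (\<forall>xs ys. length xs = j \<longrightarrow> mset xs = mset ys \<longrightarrow> P xs = P ys)"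

definition multilinear_sym_lin :: "nat \<Rightarrow> ('e list \<Rightarrow> 'e^'n \<Rightarrow> 'e::euclidean_space) \<Rightarrow> bool" where
  "multilinear_sym_lin i Q \<longleftrightarrow>
    (\<forall>y. multilinear_sym i (\<lambda>xs. Q xs y)) \<and>
    (\<forall>xs. length xs = i \<longrightarrow> linear (Q xs))"

definition Qdiag :: "(nat \<Rightarrow> 'e list \<Rightarrow> 'e^'n \<Rightarrow> 'e::euclidean_space) \<Rightarrow> nat \<Rightarrow> 'e \<Rightarrow> 'e^'n \<Rightarrow> 'e" where
  "Qdiag Q i x y = Q i (replicate i x) y"

definition Pdiag :: "(nat \<Rightarrow> 'e list \<Rightarrow> 'e::euclidean_space) \<Rightarrow> nat \<Rightarrow> 'e \<Rightarrow> 'e" where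
  "Pdiag P j x = P j (replicate j x)"

end

theory Submission
  imports Defs
begin

text \<open>
  Everything about the law of a centred Gaussian field \<open>X\<close> is encoded in the quadratic form
  \<open>q(\<psi>) = \<integral>\<psi> \<bullet> (C * \<psi>)\<close>: each \<open>X \<psi>\<close> is a centred normal variable of variance \<open>q(\<psi>)\<close>, so
  \<open>E cos (X \<psi> + c) = exp (- q(\<psi>) / 2) cos c\<close>, and a Cramer--Wold argument
  (\<open>distr_PiM_eq_if_cos_eq\<close>, \<open>law_eq_if_cos_eq\<close>) shows that these numbers determine the law of a
  random distribution.

  Stationarity is assumed, so (b) is immediate.  For (c), \<open>q\<close> is even, so \<open>- X\<close> has the law of \<open>X\<close>; and
  since \<open>C(x) = C(- x)\<close>, two changes of variables \<open>x \<mapsto> - x\<close> on the torus show that \<open>q\<close> is invariant under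
  reflection of its argument (\<open>quadratic_form_reflect\<close>), so \<open>\<R>X\<close> has that law as well.  Both values of
  \<open>\<sigma>\<close> are therefore admissible, and \<open>\<sigma> = k mod 2\<close> has the required parity.

  For (a), the law of a pair \<open>(X, Y)\<close> of independent copies is invariant under rotations
  \<open>(X cos \<theta> + Y sin \<theta>, Y cos \<theta> - X sin \<theta>)\<close>.  Joining \<open>f(X)\<close> to \<open>f(Y)\<close> along this rotation, as Maurey
  and Pisier do, gives a Poincare inequality
  \<open>Var f(X) \<le> \<pi>\<^sup>2/8 \<cdot> E (\<nabla>f(X) \<bullet> Y)\<^sup>2\<close> (\<open>poincare_inequality\<close>).  For a cylindrical functional
  \<open>G\<close> the conditional expectation of the right-hand side given \<open>X\<close> is \<open>q(\<delta>G/\<delta>\<xi>)\<close>.  It remains to bound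
  \<open>q(\<psi>)\<close> by a multiple of the squared \<open>L\<^sup>p\<close>-norm of \<open>\<psi>\<close>, where \<open>1/q\<^sub>* + 1/p = 1\<close>.  This is Young's
  convolution inequality (\<open>bilinear_form_le_Lp_norm\<close>), and it holds as soon as \<open>C\<close> is in \<open>L\<^bsup>r\<^esup>\<close> with
  \<open>r = q\<^sub>*/2 \<ge> 1\<close>, which for a kernel bounded by a multiple of \<open>|x|\<^bsup>-\<gamma>\<^esup>\<close> is
  guaranteed by \<open>\<gamma> q\<^sub>* < 2n\<close>.  The condition
  \<open>\<gamma> < min {n, 2/k}\<close> says precisely that \<open>2n/\<gamma>\<close> exceeds both \<open>2\<close> and \<open>nk\<close>, so there is room for
  \<open>q\<^sub>*\<close> above \<open>nk\<close>.
\<close>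

section \<open>Laws determined by linear combinations\<close>

text \<open>
  Levy's uniqueness theorem for the law of \<open>U\<close> under a change of measure by the density \<open>h\<close>.  The
  numbers \<open>E h cos (s U + d)\<close> carry the same information as the characteristic function: the phases
  \<open>d = 0\<close> and \<open>d = - \<pi>/2\<close> give its real and its imaginary part.
\<close>

lemma expectation_indicator_eq_if_cos_eq:
  fixes U :: "'a \<Rightarrow> real" and V :: "'b \<Rightarrow> real"
  assumes "prob_space M" "prob_space N"
    and [measurable]: "U \<in> borel_measurable M" "V \<in> borel_measurable N"
    and h [measurable]: "h \<in> borel_measurable M" "\<And>x. 0 \<le> h x" "\<And>x. h x \<le> B"
    and g [measurable]: "g \<in> borel_measurable N" "\<And>x. 0 \<le> g x" "\<And>x. g x \<le> B"
    and eq: "\<And>s d. (LINT \<omega>|M. h \<omega> * cos (s * U \<omega> + d)) = (LINT \<omega>|N. g \<omega> * cos (s * V \<omega> + d))"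
    and A [measurable]: "A \<in> sets borel"
  shows "(LINT \<omega>|M. h \<omega> * indicator A (U \<omega>)) = (LINT \<omega>|N. g \<omega> * indicator A (V \<omega>))"
proof -
  interpret M: prob_space M by fact
  interpret N: prob_space N by fact
  have int_h: "integrable M (\<lambda>\<omega>. h \<omega> * k \<omega>)"
    if [measurable]: "k \<in> borel_measurable M" and "\<And>\<omega>. \<bar>k \<omega>\<bar> \<le> 1" for k :: "'a \<Rightarrow> real"
  proof (rule M.integrable_const_bound[where B = "B"])
    show "AE x in M. norm (h x * k x) \<le> B"
      using h that by (auto simp: abs_mult intro!: AE_I2 order_trans[OF mult_mono[OF order_refl that(2)]])
  qed measurable
  have int_g: "integrable N (\<lambda>\<omega>. g \<omega> * k \<omega>)"
    if [measurable]: "k \<in> borel_measurable N" and "\<And>\<omega>. \<bar>k \<omega>\<bar> \<le> 1" for k :: "'b \<Rightarrow> real"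
  proof (rule N.integrable_const_bound[where B = "B"])
    show "AE x in N. norm (g x * k x) \<le> B"
      using g that by (auto simp: abs_mult intro!: AE_I2 order_trans[OF mult_mono[OF order_refl that(2)]])
  qed measurable
  define c where "c = (LINT \<omega>|M. h \<omega>)"
  have c_g: "c = (LINT \<omega>|N. g \<omega>)" using eq[of 0 0] by (simp add: c_def)
  have ih: "integrable M h" using int_h[of "\<lambda>_. 1"] by simp
  have ig: "integrable N g" using int_g[of "\<lambda>_. 1"] by simp
  have "c \<ge> 0" using h by (simp add: c_def)
  show ?thesis
  proof (cases "c = 0")
    case True
    then have "AE x in M. h x = 0" "AE x in N. g x = 0"
      using integral_nonneg_eq_0_iff_AE[OF ih] integral_nonneg_eq_0_iff_AE[OF ig] h g c_g
      by (auto simp: c_def)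
    then have "(LINT \<omega>|M. h \<omega> * indicator A (U \<omega>)) = (LINT \<omega>|M. 0)" "(LINT \<omega>|N. g \<omega> * indicator A (V \<omega>)) = (LINT \<omega>|N. 0)"
      by (auto intro!: integral_eq_zero_AE)
    then show ?thesis by simp
  next
    case False
    with \<open>c \<ge> 0\<close> have c: "c > 0" by simp
    \<comment> \<open>Levy's theorem is about probability measures, hence the normalisation by the total mass \<open>c\<close>.\<close>
    define \<mu> where "\<mu> = distr (density M (\<lambda>\<omega>. h \<omega> / c)) borel U"
    define \<nu> where "\<nu> = distr (density N (\<lambda>\<omega>. g \<omega> / c)) borel V"
    have I\<mu>: "(LINT x|\<mu>. f x) = (LINT \<omega>|M. h \<omega> * f (U \<omega>)) / c"
      if [measurable]: "f \<in> borel_measurable borel" for f :: "real \<Rightarrow> real"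
      using c h by (simp add: \<mu>_def integral_distr integral_density)
    have I\<nu>: "(LINT x|\<nu>. f x) = (LINT \<omega>|N. g \<omega> * f (V \<omega>)) / c"
      if [measurable]: "f \<in> borel_measurable borel" for f :: "real \<Rightarrow> real"
      using c g by (simp add: \<nu>_def integral_distr integral_density)
    have "(\<integral>\<^sup>+\<omega>. ennreal (h \<omega> / c) \<partial>M) = 1"
      using h c ih by (subst nn_integral_eq_integral) (auto simp: c_def)
    then have "prob_space (density M (\<lambda>\<omega>. h \<omega> / c))"
      by (intro prob_spaceI) (simp add: emeasure_density)
    then have "prob_space \<mu>" unfolding \<mu>_def by (rule prob_space.prob_space_distr) simp
    have "(\<integral>\<^sup>+\<omega>. ennreal (g \<omega> / c) \<partial>N) = 1"
      using g c ig by (subst nn_integral_eq_integral) (auto simp: c_g)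
    then have "prob_space (density N (\<lambda>\<omega>. g \<omega> / c))"
      by (intro prob_spaceI) (simp add: emeasure_density)
    then have "prob_space \<nu>" unfolding \<nu>_def by (rule prob_space.prob_space_distr) simp
    interpret \<mu>: prob_space \<mu> by fact
    interpret \<nu>: prob_space \<nu> by fact
    have rd: "real_distribution \<mu>" "real_distribution \<nu>"
      by (auto simp: real_distribution_def real_distribution_axioms_def \<mu>_def \<nu>_def
          \<mu>.prob_space_axioms[unfolded \<mu>_def] \<nu>.prob_space_axioms[unfolded \<nu>_def])
    interpret m: real_distribution \<mu> by fact
    interpret n: real_distribution \<nu> by fact
    have [measurable_cong]: "sets \<mu> = sets borel" "sets \<nu> = sets borel" by (simp_all add: \<mu>_def \<nu>_def)
    have iexp: "integrable \<mu> (\<lambda>x. iexp (t * x))" "integrable \<nu> (\<lambda>x. iexp (t * x))" for t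
      using \<mu>.integrable_iexp[of "\<lambda>x. complex_of_real (t * x)"] \<nu>.integrable_iexp[of "\<lambda>x. complex_of_real (t * x)"]
      by simp_all
    have Re_Im: "Re (iexp x) = cos (x + 0)" "Im (iexp x) = cos (x + - (pi/2))" for x
      by (auto simp: Re_exp Im_exp cos_add cos_diff)
    have "char \<mu> t = char \<nu> t" for t
    proof (rule complex_eqI)
      show "Re (char \<mu> t) = Re (char \<nu> t)"
        unfolding char_def integral_Re[OF iexp(1), symmetric] integral_Re[OF iexp(2), symmetric] Re_Im
        by (subst I\<mu> I\<nu>, measurable)+ (simp only: eq)
      show "Im (char \<mu> t) = Im (char \<nu> t)"
        unfolding char_def integral_Im[OF iexp(1), symmetric] integral_Im[OF iexp(2), symmetric] Re_Im
        by (subst I\<mu> I\<nu>, measurable)+ (simp only: eq)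
    qed
    then have "\<mu> = \<nu>" using rd by (intro Levy_uniqueness) auto
    then show ?thesis using c I\<mu>[of "indicator A"] I\<nu>[of "indicator A"] by simp
  qed
qed

text \<open>
  The indicators are introduced one coordinate at a time.  To fix the coordinate \<open>j\<close>, the previous
  lemma needs a nonnegative density, while the induction hypothesis is about the signed weight
  \<open>cos (t \<bullet> U + c)\<close>; using \<open>1 + cos (t \<bullet> U + c)\<close> as density repairs this, and its product
  with \<open>cos (s U\<^sub>j + d)\<close> splits into cosines of linear forms again.
\<close>

lemma cylinder_probability_eq_if_cos_eq:
  fixes U :: "'i \<Rightarrow> 'a \<Rightarrow> real" and V :: "'i \<Rightarrow> 'b \<Rightarrow> real"
  assumes M: "prob_space M" and N: "prob_space N" and K: "finite K"
    and U [measurable]: "\<And>i. i \<in> K \<Longrightarrow> U i \<in> borel_measurable M"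
    and V [measurable]: "\<And>i. i \<in> K \<Longrightarrow> V i \<in> borel_measurable N"
    and eq: "\<And>t c. (LINT \<omega>|M. cos ((\<Sum>i\<in>K. t i * U i \<omega>) + c)) = (LINT \<omega>|N. cos ((\<Sum>i\<in>K. t i * V i \<omega>) + c))"
    and A [measurable]: "\<And>i. i \<in> K \<Longrightarrow> A i \<in> sets borel"
  shows "J \<subseteq> K \<Longrightarrow>
    (LINT \<omega>|M. (\<Prod>i\<in>J. indicator (A i) (U i \<omega>)) * cos ((\<Sum>i\<in>K. t i * U i \<omega>) + c)) =
    (LINT \<omega>|N. (\<Prod>i\<in>J. indicator (A i) (V i \<omega>)) * cos ((\<Sum>i\<in>K. t i * V i \<omega>) + c))"
proof -
  interpret M: prob_space M by fact
  interpret N: prob_space N by fact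
  assume "J \<subseteq> K"
  then have "finite J" using K finite_subset by blast
  then show ?thesis using \<open>J \<subseteq> K\<close>
  proof (induction J arbitrary: t c rule: finite_induct)
    case empty
    then show ?case using eq by simp
  next
    case (insert j J)
    then have jK: "j \<in> K" and JK: "J \<subseteq> K" by auto
    then have [measurable]: "\<And>i. i \<in> J \<Longrightarrow> U i \<in> borel_measurable M" "\<And>i. i \<in> J \<Longrightarrow> V i \<in> borel_measurable N"
       "\<And>i. i \<in> J \<Longrightarrow> A i \<in> sets borel" "U j \<in> borel_measurable M" "V j \<in> borel_measurable N" "A j \<in> sets borel"
      using U V A by auto
    define a where "a \<omega> = (\<Prod>i\<in>J. indicator (A i) (U i \<omega>) :: real)" for \<omega>
    define b where "b \<omega> = (\<Prod>i\<in>J. indicator (A i) (V i \<omega>) :: real)" for \<omega>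
    define S where "S t \<omega> = (\<Sum>i\<in>K. t i * U i \<omega>)" for t \<omega>
    define T where "T t \<omega> = (\<Sum>i\<in>K. t i * V i \<omega>)" for t \<omega>
    have [measurable]: "a \<in> borel_measurable M" "b \<in> borel_measurable N"
       unfolding a_def[abs_def] b_def[abs_def] by measurable
    have [measurable]: "S t \<in> borel_measurable M" "T t \<in> borel_measurable N" for t
       unfolding S_def[abs_def] T_def[abs_def] by measurable
    have a: "0 \<le> a \<omega>" "a \<omega> \<le> 1" for \<omega>
      by (auto simp: a_def intro!: prod_nonneg prod_le_1)
    have b: "0 \<le> b \<omega>" "b \<omega> \<le> 1" for \<omega>
      by (auto simp: b_def intro!: prod_nonneg prod_le_1)
    have IH: "(LINT \<omega>|M. a \<omega> * cos (S t \<omega> + c)) = (LINT \<omega>|N. b \<omega> * cos (T t \<omega> + c))" for t c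
      using insert.IH[OF JK] by (simp add: a_def b_def S_def T_def)
    have ia: "integrable M (\<lambda>\<omega>. a \<omega> * k \<omega>)"
      if [measurable]: "k \<in> borel_measurable M" and "\<And>\<omega>. \<bar>k \<omega>\<bar> \<le> 1" for k
    proof (rule M.integrable_const_bound[where B = 1])
      show "AE x in M. norm (a x * k x) \<le> 1"
        using a that by (auto simp: abs_mult intro!: mult_le_one)
    qed measurable
    have ib: "integrable N (\<lambda>\<omega>. b \<omega> * k \<omega>)"
      if [measurable]: "k \<in> borel_measurable N" and "\<And>\<omega>. \<bar>k \<omega>\<bar> \<le> 1" for k
    proof (rule N.integrable_const_bound[where B = 1])
      show "AE x in N. norm (b x * k x) \<le> 1"
        using b that by (auto simp: abs_mult intro!: mult_le_one)
    qed measurable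
    have S_upd: "S (t(j := t j + s)) \<omega> = S t \<omega> + s * U j \<omega>" for t s \<omega>
      unfolding S_def using K jK by (simp add: sum.remove[of K j] algebra_simps)
    have T_upd: "T (t(j := t j + s)) \<omega> = T t \<omega> + s * V j \<omega>" for t s \<omega>
      unfolding T_def using K jK by (simp add: sum.remove[of K j] algebra_simps)
    have base: "(LINT \<omega>|M. a \<omega> * cos (s * U j \<omega> + d)) = (LINT \<omega>|N. b \<omega> * cos (s * V j \<omega> + d))" for s d
      using IH[of "(\<lambda>_. 0)(j := 0 + s)" d]  S_upd[of "\<lambda>_. 0" s] T_upd[of "\<lambda>_. 0" s] by (simp add: S_def T_def)
    have split: "a * (1 + cos p) * cos q = a * cos q + (a * cos (p + q) + a * cos (p - q)) / 2" for a p q :: real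
      by (simp add: cos_add cos_diff algebra_simps)
    have weighted: "(LINT \<omega>|M. (a \<omega> * (1 + cos (S t \<omega> + c))) * cos (s * U j \<omega> + d)) =
        (LINT \<omega>|N. (b \<omega> * (1 + cos (T t \<omega> + c))) * cos (s * V j \<omega> + d))" for t c s d
    proof -
      have "(LINT \<omega>|M. (a \<omega> * (1 + cos (S t \<omega> + c))) * cos (s * U j \<omega> + d)) =
        (LINT \<omega>|M. a \<omega> * cos (s * U j \<omega> + d)) + ((LINT \<omega>|M. a \<omega> * cos (S t \<omega> + c + (s * U j \<omega> + d)))
          + (LINT \<omega>|M. a \<omega> * cos (S t \<omega> + c - (s * U j \<omega> + d)))) / 2"
        unfolding split by (simp add: ia)
      also have "\<dots> =
        (LINT \<omega>|N. b \<omega> * cos (s * V j \<omega> + d)) + ((LINT \<omega>|N. b \<omega> * cos (T t \<omega> + c + (s * V j \<omega> + d)))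
          + (LINT \<omega>|N. b \<omega> * cos (T t \<omega> + c - (s * V j \<omega> + d)))) / 2"
        using base[of s d] IH[of "t(j := t j + s)" "c + d"] IH[of "t(j := t j + - s)" "c - d"]
        by (simp only: S_upd T_upd) (simp add: algebra_simps)
      also have "\<dots> = (LINT \<omega>|N. (b \<omega> * (1 + cos (T t \<omega> + c))) * cos (s * V j \<omega> + d))"
        unfolding split by (simp add: ib)
      finally show ?thesis .
    qed
    have step: "(LINT \<omega>|M. (a \<omega> * (1 + cos (S t \<omega> + c))) * indicator (A j) (U j \<omega>)) =
        (LINT \<omega>|N. (b \<omega> * (1 + cos (T t \<omega> + c))) * indicator (A j) (V j \<omega>))" for t c
    proof (rule expectation_indicator_eq_if_cos_eq[OF M N, where B = 2])
      have le2: "0 \<le> x * (1 + cos y)" "x * (1 + cos y) \<le> 2" if "0 \<le> x" "x \<le> 1" for x y :: real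
      proof -
        have "0 \<le> 1 + cos y" "1 + cos y \<le> 2" using cos_ge_minus_one[of y] cos_le_one[of y] by linarith+
        then show "0 \<le> x * (1 + cos y)" "x * (1 + cos y) \<le> 2"
          using that mult_mono[of x 1 "1 + cos y" 2] by simp_all
      qed
      show "0 \<le> a x * (1 + cos (S t x + c))" "a x * (1 + cos (S t x + c)) \<le> 2" for x using le2 a by auto
      show "0 \<le> b x * (1 + cos (T t x + c))" "b x * (1 + cos (T t x + c)) \<le> 2" for x using le2 b by auto
    qed (use weighted in auto)
    have expand: "(LINT \<omega>|M. (a \<omega> * (1 + cos (S t \<omega> + c))) * indicator (A j) (U j \<omega>)) =
       (LINT \<omega>|M. a \<omega> * indicator (A j) (U j \<omega>)) + (LINT \<omega>|M. a \<omega> * (indicator (A j) (U j \<omega>) * cos (S t \<omega> + c)))"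
       "(LINT \<omega>|N. (b \<omega> * (1 + cos (T t \<omega> + c))) * indicator (A j) (V j \<omega>)) =
       (LINT \<omega>|N. b \<omega> * indicator (A j) (V j \<omega>)) + (LINT \<omega>|N. b \<omega> * (indicator (A j) (V j \<omega>) * cos (T t \<omega> + c)))" for t c
      by (subst Bochner_Integration.integral_add[symmetric], 
          (intro ia ib; simp add: abs_mult split: split_indicator; fail)+, simp add: algebra_simps)+
    \<comment> \<open>With \<open>t = 0\<close> and \<open>c = \<pi>/2\<close> the cosine in the density vanishes.\<close>
    have "(LINT \<omega>|M. a \<omega> * indicator (A j) (U j \<omega>)) = (LINT \<omega>|N. b \<omega> * indicator (A j) (V j \<omega>))"
      using step[of "\<lambda>_. 0" "pi/2"] by (simp add: S_def T_def)
    then have "(LINT \<omega>|M. a \<omega> * (indicator (A j) (U j \<omega>) * cos (S t \<omega> + c))) = 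
       (LINT \<omega>|N. b \<omega> * (indicator (A j) (V j \<omega>) * cos (T t \<omega> + c)))"
      using step[of t c] expand by simp
    then show ?case using insert by (simp add: a_def b_def S_def T_def mult_ac)
  qed
qed

text \<open>
  A Cramer--Wold theorem for arbitrary index sets: the joint law of a family of real random variables
  is determined by the laws of its finite linear combinations.  A product measure is determined by
  cylinder sets, which involve finitely many coordinates only.
\<close>

theorem distr_PiM_eq_if_cos_eq:
  fixes U :: "'i \<Rightarrow> 'a \<Rightarrow> real" and V :: "'i \<Rightarrow> 'b \<Rightarrow> real"
  assumes M: "prob_space M" and N: "prob_space N"
    and U: "\<And>i. i \<in> I \<Longrightarrow> U i \<in> borel_measurable M"
    and V: "\<And>i. i \<in> I \<Longrightarrow> V i \<in> borel_measurable N"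
    and eq: "\<And>K t c. finite K \<Longrightarrow> K \<subseteq> I \<Longrightarrow>
      (LINT \<omega>|M. cos ((\<Sum>i\<in>K. t i * U i \<omega>) + c)) = (LINT \<omega>|N. cos ((\<Sum>i\<in>K. t i * V i \<omega>) + c))"
  shows "distr M (\<Pi>\<^sub>M i\<in>I. borel) (\<lambda>\<omega>. \<lambda>i\<in>I. U i \<omega>) = distr N (\<Pi>\<^sub>M i\<in>I. borel) (\<lambda>\<omega>. \<lambda>i\<in>I. V i \<omega>)"
    (is "?P = ?Q")
proof (rule measure_eqI_PiM_infinite)
  interpret M: prob_space M by fact
  interpret N: prob_space N by fact
  have mU [measurable]: "(\<lambda>\<omega>. \<lambda>i\<in>I. U i \<omega>) \<in> M \<rightarrow>\<^sub>M (\<Pi>\<^sub>M i\<in>I. borel)" using U by (intro measurable_restrict) 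
  have mV [measurable]: "(\<lambda>\<omega>. \<lambda>i\<in>I. V i \<omega>) \<in> N \<rightarrow>\<^sub>M (\<Pi>\<^sub>M i\<in>I. borel)" using V by (intro measurable_restrict) 
  show "finite_measure ?P" by (rule M.finite_measure_distr) measurable
  fix A :: "'i \<Rightarrow> real set" and J
  assume J: "finite J" "J \<subseteq> I" and A: "\<And>i. i \<in> J \<Longrightarrow> A i \<in> sets borel"
  have sets: "prod_emb I (\<lambda>_. borel) J (Pi\<^sub>E J A) \<in> sets (\<Pi>\<^sub>M i\<in>I. (borel :: real measure))"
    using J A by (intro sets_PiM_I) auto
  let ?E = "prod_emb I (\<lambda>_. borel :: real measure) J (Pi\<^sub>E J A)"
  have in_emb: "(\<lambda>i\<in>I. f i) \<in> ?E \<longleftrightarrow> (\<forall>i\<in>J. f i \<in> A i)" for f :: "'i \<Rightarrow> real"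
    using J(2) by (auto simp: prod_emb_def PiE_def Pi_def)
  have prob: "measure (distr L (\<Pi>\<^sub>M i\<in>I. borel) (\<lambda>\<omega>. \<lambda>i\<in>I. W i \<omega>)) ?E = (LINT \<omega>|L. (\<Prod>i\<in>J. indicator (A i) (W i \<omega>)))"
    if m: "(\<lambda>\<omega>. \<lambda>i\<in>I. W i \<omega>) \<in> L \<rightarrow>\<^sub>M (\<Pi>\<^sub>M i\<in>I. borel)" for W :: "'i \<Rightarrow> 'c \<Rightarrow> real" and L
  proof -
    have "(LINT \<omega>|L. (\<Prod>i\<in>J. indicator (A i) (W i \<omega>) :: real)) = (LINT \<omega>|L. indicator ?E (\<lambda>i\<in>I. W i \<omega>))"
      using J(1) by (intro Bochner_Integration.integral_cong refl) (auto simp: indicator_def in_emb)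
    also have "\<dots> = (LINT x|distr L (\<Pi>\<^sub>M i\<in>I. borel) (\<lambda>\<omega>. \<lambda>i\<in>I. W i \<omega>). indicator ?E x)"
      using sets m by (subst integral_distr) auto
    also have "\<dots> = measure (distr L (\<Pi>\<^sub>M i\<in>I. borel) (\<lambda>\<omega>. \<lambda>i\<in>I. W i \<omega>)) ?E"
      using sets sets.sets_into_space[OF sets] by (simp add: Int_absorb2)
    finally show ?thesis by simp
  qed
  have "measure ?P ?E = measure ?Q ?E"
    unfolding prob[OF mU] prob[OF mV]
    using cylinder_probability_eq_if_cos_eq[OF M N J(1), of U V A J "\<lambda>_. 0" 0] J U V A eq[OF J] by auto
  moreover have "finite_measure ?P" by (rule M.finite_measure_distr) measurable
  moreover have "finite_measure ?Q" by (rule N.finite_measure_distr) measurable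
  ultimately show "emeasure ?P ?E = emeasure ?Q ?E"
    by (simp add: finite_measure.emeasure_eq_measure)
qed simp_all

section \<open>The chain rule for smooth functions of finitely many coordinates\<close>

lemma smooth_seq_has_pderiv:
  assumes "smooth_seq m f" "i < m"
  shows "((\<lambda>u. f (x(i := u))) has_real_derivative pderiv_seq i f (x(i := u))) (at u)"
proof -
  have "\<forall>x. (\<lambda>t. foldr pderiv_seq [] f (x(i := t))) differentiable (at (x i))"
    using assms unfolding smooth_seq_def by (metis empty_set empty_subsetI)
  then have "(\<lambda>t. f ((x(i := u))(i := t))) differentiable (at ((x(i := u)) i))"
    by (metis (no_types) foldr.simps(1) id_apply)
  then show ?thesis
    unfolding pderiv_seq_def
    by (simp add: DERIV_deriv_iff_real_differentiable)
qed

lemma smooth_seq_continuous_pderiv: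
  assumes "smooth_seq m f" "i < m"
  shows "continuous_on UNIV (pderiv_seq i f)"
proof -
  have "continuous_on UNIV (foldr pderiv_seq [i] f)"
    using assms unfolding smooth_seq_def by (metis empty_set empty_subsetI insert_subset lessThan_iff list.simps(15))
  then show ?thesis by simp
qed

lemma smooth_seq_continuous:
  assumes "smooth_seq m f"
  shows "continuous_on UNIV f"
proof -
  have "continuous_on UNIV (foldr pderiv_seq [] f)"
    using assms unfolding smooth_seq_def by (metis empty_set empty_subsetI)
  then show ?thesis by (simp add: id_def)
qed

lemma smooth_seq_cong:
  assumes "smooth_seq m f" "\<And>i. i < m \<Longrightarrow> x i = y i"
  shows "f x = f y"
  using assms unfolding smooth_seq_def by blast

lemma smooth_seq_pderiv_cong:
  assumes "smooth_seq m f" "\<And>j. j < m \<Longrightarrow> x j = y j" "i < m"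
  shows "pderiv_seq i f x = pderiv_seq i f y"
proof -
  have "f (x(i := t)) = f (y(i := t))" for t
    using assms by (intro smooth_seq_cong[OF assms(1)]) auto
  then show ?thesis using assms by (simp add: pderiv_seq_def)
qed

lemma smooth_seq_MVT:
  assumes f: "smooth_seq m f" "i < m"
  obtains \<xi> where "\<bar>\<xi> - u\<bar> \<le> \<bar>v - u\<bar>"
    and "f (x(i := v)) - f (x(i := u)) = pderiv_seq i f (x(i := \<xi>)) * (v - u)"
proof -
  note d = smooth_seq_has_pderiv[OF f, of x]
  consider "u < v" | "u = v" | "v < u" by linarith
  then show ?thesis
  proof cases
    case 1
    obtain z where "u < z" "z < v" "f (x(i := v)) - f (x(i := u)) = (v - u) * pderiv_seq i f (x(i := z))"
      using MVT2[OF 1, of "\<lambda>u. f (x(i := u))" "\<lambda>u. pderiv_seq i f (x(i := u))"] d by auto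
    then show ?thesis by (intro that[of z]) (auto simp: mult.commute)
  next
    case 2
    then show ?thesis by (intro that[of u]) auto
  next
    case 3
    obtain z where "v < z" "z < u" "f (x(i := u)) - f (x(i := v)) = (u - v) * pderiv_seq i f (x(i := z))"
      using MVT2[OF 3, of "\<lambda>u. f (x(i := u))" "\<lambda>u. pderiv_seq i f (x(i := u))"] d by auto
    then show ?thesis by (intro that[of z]) (auto simp: algebra_simps)
  qed
qed

text \<open>
  A function with continuous partial derivatives is differentiable along curves: change the
  coordinates one after the other and apply the mean value theorem to each change.  Coordinates from
  \<open>m\<close> on may move arbitrarily, since \<open>f\<close> ignores them.
\<close>

lemma smooth_seq_chain_rule:
  assumes f: "smooth_seq m f"
    and c: "\<And>i. i < m \<Longrightarrow> ((\<lambda>s. c s i) has_real_derivative c' i) (at t)"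
  shows "((\<lambda>s. f (c s)) has_real_derivative (\<Sum>i<m. pderiv_seq i f (c t) * c' i)) (at t)"
proof -
  \<comment> \<open>The curve in the first \<open>j\<close> coordinates, frozen at time \<open>t\<close> in the others.\<close>
  define z where "z j s = (\<lambda>i. if i < j then c s i else c t i)" for j s
  have z0: "z 0 s = c t" "z j t = c t" for s j by (auto simp: z_def)
  have zm: "f (z m s) = f (c s)" for s by (intro smooth_seq_cong[OF f]) (auto simp: z_def)
  have z_Suc: "z (Suc j) s = (z j s)(j := c s j)" "z j s = (z j s)(j := c t j)" for j s
    by (auto simp: z_def fun_eq_iff less_Suc_eq)
  have step: "((\<lambda>s. f (z (Suc j) s) - f (z j s)) has_real_derivative pderiv_seq j f (c t) * c' j) (at t)"
    if j: "j < m" for j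
  proof -
    have "\<exists>\<xi>. \<bar>\<xi> - c t j\<bar> \<le> \<bar>c s j - c t j\<bar> \<and>
        f (z (Suc j) s) - f (z j s) = pderiv_seq j f ((z j s)(j := \<xi>)) * (c s j - c t j)" for s
      using smooth_seq_MVT[OF f j, of "c t j" "c s j" "z j s"] z_Suc by metis
    then obtain \<xi> where \<xi>: "\<And>s. \<bar>\<xi> s - c t j\<bar> \<le> \<bar>c s j - c t j\<bar>"
        "\<And>s. f (z (Suc j) s) - f (z j s) = pderiv_seq j f ((z j s)(j := \<xi> s)) * (c s j - c t j)"
      by metis
    have c_cont: "((\<lambda>s. c s i) \<longlongrightarrow> c t i) (at t)" if "i < m" for i
      using DERIV_isCont[OF c[OF that]] by (simp add: isCont_def)
    have "((\<lambda>s. c s j - c t j) \<longlongrightarrow> 0) (at t)"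
      using c_cont[OF j] by (simp add: LIM_zero)
    then have "((\<lambda>s. \<xi> s - c t j) \<longlongrightarrow> 0) (at t)"
      by (rule Lim_transform_bound[rotated]) (auto simp: \<xi>)
    then have \<xi>_lim: "(\<xi> \<longlongrightarrow> c t j) (at t)" by (simp add: LIM_zero_iff)
    have "((\<lambda>s. (z j s)(j := \<xi> s)) \<longlongrightarrow> c t) (at t)"
    proof -
      have "((\<lambda>s. ((z j s)(j := \<xi> s)) i) \<longlongrightarrow> c t i) (at t)" for i
        using \<xi>_lim c_cont[of i] j by (cases "i = j"; cases "i < j") (auto simp: z_def)
      then have "limitin (product_topology (\<lambda>i. euclidean) UNIV) (\<lambda>s. (z j s)(j := \<xi> s)) (c t) (at t)"
        unfolding limitin_componentwise by simp
      then show ?thesis by (simp add: euclidean_product_topology)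
    qed
    then have "((\<lambda>s. pderiv_seq j f ((z j s)(j := \<xi> s))) \<longlongrightarrow> pderiv_seq j f (c t)) (at t)"
      using smooth_seq_continuous_pderiv[OF f j]
      by (intro isCont_tendsto_compose[of "c t" "pderiv_seq j f"]) (auto simp: continuous_on_eq_continuous_at)
    moreover have "((\<lambda>s. (c s j - c t j) / (s - t)) \<longlongrightarrow> c' j) (at t)"
      using c[OF j] by (simp add: has_field_derivative_iff)
    ultimately have "((\<lambda>s. pderiv_seq j f ((z j s)(j := \<xi> s)) * ((c s j - c t j) / (s - t))) 
        \<longlongrightarrow> pderiv_seq j f (c t) * c' j) (at t)"
      by (rule tendsto_mult)
    then show ?thesis
      by (simp add: has_field_derivative_iff z0 \<xi>(2))
  qed
  have "((\<lambda>s. f (c t) + (\<Sum>j<m. f (z (Suc j) s) - f (z j s))) has_real_derivative (0 + (\<Sum>j<m. pderiv_seq j f (c t) * c' j))) (at t)"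
    using step by (intro derivative_intros) auto
  moreover have "(\<lambda>s. f (c t) + (\<Sum>j<m. f (z (Suc j) s) - f (z j s))) = (\<lambda>s. f (c s))"
    using sum_lessThan_telescope[of "\<lambda>j. f (z j s)" m for s] by (simp add: z0 zm fun_eq_iff)
  ultimately show ?thesis by simp
qed

section \<open>A Poincare inequality for Gaussian variables\<close>

text \<open>
  A linear space of centred normal variables.  Normality is expressed through the expectation of
  cosines, the only form in which it is used; closure under linear combinations makes finite
  families jointly Gaussian.
\<close>

locale centred_gaussian_space = prob_space M for M :: "'w measure" +
  fixes G :: "('w \<Rightarrow> real) set"
  assumes measurable_G: "L \<in> G \<Longrightarrow> L \<in> borel_measurable M"
    and square_integrable: "L \<in> G \<Longrightarrow> integrable M (\<lambda>\<omega>. (L \<omega>)\<^sup>2)"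
    and expectation_cos: "L \<in> G \<Longrightarrow> expectation (\<lambda>\<omega>. cos (L \<omega> + c)) = exp (- expectation (\<lambda>\<omega>. (L \<omega>)\<^sup>2) / 2) * cos c"
    and linear_comb: "L \<in> G \<Longrightarrow> L' \<in> G \<Longrightarrow> (\<lambda>\<omega>. a * L \<omega> + b * L' \<omega>) \<in> G"
begin

lemma sum_mem:
  assumes "finite K" "K \<noteq> {}" "\<And>k. k \<in> K \<Longrightarrow> L k \<in> G"
  shows "(\<lambda>\<omega>. \<Sum>k\<in>K. t k * L k \<omega>) \<in> G"
  using assms
proof (induction K rule: finite_ne_induct)
  case (singleton k)
  then show ?case using linear_comb[of "L k" "L k" "t k" 0] by simp
next
  case (insert k K)
  then show ?case using linear_comb[of "L k" "(\<lambda>\<omega>. \<Sum>k\<in>K. t k * L k \<omega>)" "t k" 1] by simp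
qed

text \<open>
  On the product space, \<open>A\<close> in the first and \<open>B\<close> in the second coordinate are independent, so
  variances add.
\<close>

lemma expectation_cos_independent_sum:
  assumes A: "A \<in> G" and B: "B \<in> G"
  shows "(LINT p|(M \<Otimes>\<^sub>M M). cos ((A (fst p) + B (snd p)) + c)) =
    exp (- (expectation (\<lambda>\<omega>. (A \<omega>)\<^sup>2) + expectation (\<lambda>\<omega>. (B \<omega>)\<^sup>2)) / 2) * cos c"
proof -
  interpret PP: pair_prob_space M M ..
  note [measurable] = measurable_G[OF A] measurable_G[OF B]
  have "integrable (M \<Otimes>\<^sub>M M) (\<lambda>p. cos ((A (fst p) + B (snd p)) + c))"
    by (rule PP.P.integrable_const_bound[where B = 1]) auto
  from PP.integral_fst'[OF this]
  have "(LINT p|(M \<Otimes>\<^sub>M M). cos ((A (fst p) + B (snd p)) + c)) =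
      (LINT \<omega>|M. LINT \<omega>'|M. cos (B \<omega>' + (A \<omega> + c)))"
    by (simp only: fst_conv snd_conv add.commute[of "A _" "B _"] add.assoc)
  also have "\<dots> = exp (- expectation (\<lambda>\<omega>. (B \<omega>)\<^sup>2) / 2) * (LINT \<omega>|M. cos (A \<omega> + c))"
    by (simp only: expectation_cos[OF B] integral_mult_right_zero)
  also have "\<dots> = exp (- (expectation (\<lambda>\<omega>. (A \<omega>)\<^sup>2) + expectation (\<lambda>\<omega>. (B \<omega>)\<^sup>2)) / 2) * cos c"
    by (simp only: expectation_cos[OF A] minus_add_distrib add_divide_distrib exp_add mult_ac)
  finally show ?thesis .
qed

text \<open>
  The two components of a rotation by \<open>\<theta>\<close> of a pair of independent copies, tagged by \<open>True\<close> and
  \<open>False\<close>.  The second is the derivative of the first with respect to \<open>\<theta>\<close>.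
\<close>

definition rotated :: "('w \<Rightarrow> nat \<Rightarrow> real) \<Rightarrow> real \<Rightarrow> 'w \<times> 'w \<Rightarrow> bool \<times> nat \<Rightarrow> real" where
  "rotated x \<theta> p = (\<lambda>(b, i). if b then cos \<theta> * x (fst p) i + sin \<theta> * x (snd p) i
                               else cos \<theta> * x (snd p) i - sin \<theta> * x (fst p) i)"

text \<open>
  A linear combination of the rotated pair is \<open>A cos \<theta> - B sin \<theta>\<close> in the first copy plus
  \<open>A sin \<theta> + B cos \<theta>\<close> in the second, for some \<open>A\<close> and \<open>B\<close> in \<open>G\<close>.  By independence its variance is
  \<open>E (A\<^sup>2 + B\<^sup>2)\<close>, whatever \<open>\<theta>\<close> is.
\<close>

lemma distr_rotated:
  assumes x: "\<And>i. (\<lambda>\<omega>. x \<omega> i) \<in> G"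
  shows "distr (M \<Otimes>\<^sub>M M) (\<Pi>\<^sub>M k\<in>UNIV. borel) (rotated x \<theta>) =
         distr (M \<Otimes>\<^sub>M M) (\<Pi>\<^sub>M k\<in>UNIV. borel) (rotated x 0)"
proof -
  interpret PP: pair_prob_space M M ..
  note [measurable] = measurable_G[OF x]
  have [measurable]: "(\<lambda>p. rotated x \<theta> p k) \<in> borel_measurable (M \<Otimes>\<^sub>M M)" for k \<theta>
    by (cases k; cases "fst k") (auto simp: rotated_def)
  have char: "(LINT p|(M \<Otimes>\<^sub>M M). cos ((\<Sum>k\<in>K. t k * rotated x \<theta> p k) + c)) =
      exp (- expectation (\<lambda>\<omega>. (\<Sum>k\<in>K. (if fst k then t k else 0) * x \<omega> (snd k))\<^sup>2 +
          (\<Sum>k\<in>K. (if fst k then 0 else t k) * x \<omega> (snd k))\<^sup>2) / 2) * cos c"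
    if K: "finite K" "K \<noteq> {}" for K t c \<theta>
  proof -
    define A where "A = (\<lambda>\<omega>. \<Sum>k\<in>K. (if fst k then t k else 0) * x \<omega> (snd k))"
    define B where "B = (\<lambda>\<omega>. \<Sum>k\<in>K. (if fst k then 0 else t k) * x \<omega> (snd k))"
    have AB: "A \<in> G" "B \<in> G" unfolding A_def B_def using sum_mem[OF K] x by auto
    define A' where "A' = (\<lambda>\<omega>. cos \<theta> * A \<omega> + - sin \<theta> * B \<omega>)"
    define B' where "B' = (\<lambda>\<omega>. sin \<theta> * A \<omega> + cos \<theta> * B \<omega>)"
    have AB': "A' \<in> G" "B' \<in> G" unfolding A'_def B'_def by (rule linear_comb[OF AB])+
    have "(\<Sum>k\<in>K. t k * rotated x \<theta> p k) = A' (fst p) + B' (snd p)" for p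
      unfolding A'_def B'_def A_def B_def sum_distrib_left sum.distrib[symmetric]
      by (intro sum.cong refl) (auto simp: rotated_def algebra_simps split: prod.split)
    then have "(LINT p|(M \<Otimes>\<^sub>M M). cos ((\<Sum>k\<in>K. t k * rotated x \<theta> p k) + c)) =
       exp (- (expectation (\<lambda>\<omega>. (A' \<omega>)\<^sup>2) + expectation (\<lambda>\<omega>. (B' \<omega>)\<^sup>2)) / 2) * cos c"
      using expectation_cos_independent_sum[OF AB'] by simp
    also have "expectation (\<lambda>\<omega>. (A' \<omega>)\<^sup>2) + expectation (\<lambda>\<omega>. (B' \<omega>)\<^sup>2) = expectation (\<lambda>\<omega>. (A' \<omega>)\<^sup>2 + (B' \<omega>)\<^sup>2)"
      using square_integrable AB' by simp
    also have "(\<lambda>\<omega>. (A' \<omega>)\<^sup>2 + (B' \<omega>)\<^sup>2) = (\<lambda>\<omega>. (A \<omega>)\<^sup>2 + (B \<omega>)\<^sup>2)"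
    proof
      fix \<omega>
      have "(A' \<omega>)\<^sup>2 + (B' \<omega>)\<^sup>2 = ((sin \<theta>)\<^sup>2 + (cos \<theta>)\<^sup>2) * ((A \<omega>)\<^sup>2 + (B \<omega>)\<^sup>2)"
        unfolding A'_def B'_def by algebra
      then show "(A' \<omega>)\<^sup>2 + (B' \<omega>)\<^sup>2 = (A \<omega>)\<^sup>2 + (B \<omega>)\<^sup>2" by simp
    qed
    finally show ?thesis unfolding A_def B_def .
  qed
  have "distr (M \<Otimes>\<^sub>M M) (\<Pi>\<^sub>M k\<in>UNIV. borel) (\<lambda>p. \<lambda>k\<in>UNIV. rotated x \<theta> p k) =
         distr (M \<Otimes>\<^sub>M M) (\<Pi>\<^sub>M k\<in>UNIV. borel) (\<lambda>p. \<lambda>k\<in>UNIV. rotated x 0 p k)"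
  proof (rule distr_PiM_eq_if_cos_eq)
    fix K :: "(bool \<times> nat) set" and t :: "bool \<times> nat \<Rightarrow> real" and c
    assume "finite K"
    then show "(LINT p|(M \<Otimes>\<^sub>M M). cos ((\<Sum>k\<in>K. t k * rotated x \<theta> p k) + c)) =
      (LINT p|(M \<Otimes>\<^sub>M M). cos ((\<Sum>k\<in>K. t k * rotated x 0 p k) + c))"
      by (cases "K = {}") (simp_all add: char)
  qed (auto intro: PP.prob_space_axioms PP.P.prob_space_axioms)
  then show ?thesis by (simp add: restrict_def)
qed

end

text \<open>
  The Cauchy--Schwarz inequality for \<open>f(b) - f(a) = \<integral> f'\<close>, obtained from the nonnegativity of the
  variance of \<open>f'\<close> on \<open>[a, b]\<close>.
\<close>

lemma square_increment_le:
  fixes f :: "real \<Rightarrow> real"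
  assumes "a < b" and d: "\<And>x. (f has_real_derivative f' x) (at x)" and cont: "continuous_on UNIV f'"
  shows "ennreal ((f b - f a)\<^sup>2) \<le> ennreal (b - a) * (\<integral>\<^sup>+x. ennreal ((f' x)\<^sup>2) * indicator {a..b} x \<partial>lborel)"
proof -
  let ?I = "\<lambda>g. LINT x|lborel. indicator {a..b} x * g x"
  have int: "integrable lborel (\<lambda>x. indicator {a..b} x * g x)" if "continuous_on UNIV g" for g :: "real \<Rightarrow> real"
    using borel_integrable_atLeastAtMost'[of a b g] that continuous_on_subset[OF that]
    by (simp add: set_integrable_def)
  have cont2: "continuous_on UNIV (\<lambda>x. (f' x)\<^sup>2)" by (intro continuous_intros cont)
  have FTC: "?I f' = f b - f a"
    using integral_FTC_Icc_real[of a b f f'] assms cont by (simp add: continuous_on_eq_continuous_at mult.commute)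
  define D where "D = (f b - f a) / (b - a)"
  have "0 \<le> ?I (\<lambda>x. (f' x - D)\<^sup>2)" by (simp add: integral_nonneg_AE)
  also have "\<dots> = ?I (\<lambda>x. (f' x)\<^sup>2) - 2 * D * ?I f' + D\<^sup>2 * ?I (\<lambda>_. 1)"
  proof -
    have "?I (\<lambda>x. (f' x - D)\<^sup>2) = (LINT x|lborel. indicator {a..b} x * (f' x)\<^sup>2 - 2 * D * (indicator {a..b} x * f' x) + D\<^sup>2 * (indicator {a..b} x * 1))"
      by (intro Bochner_Integration.integral_cong refl) (simp add: power2_eq_square algebra_simps)
    then show ?thesis
      using int[OF cont] int[OF cont2] int[OF continuous_on_const[of UNIV 1]] by simp
  qed
  also have "?I (\<lambda>_. 1) = b - a" using \<open>a < b\<close> by simp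
  also have "?I (\<lambda>x. (f' x)\<^sup>2) - 2 * D * ?I f' + D\<^sup>2 * (b - a) = ?I (\<lambda>x. (f' x)\<^sup>2) - (f b - f a)\<^sup>2 / (b - a)"
  proof -
    have "D * (b - a) = f b - f a" using \<open>a < b\<close> by (simp add: D_def)
    then have "D\<^sup>2 * (b - a) = D * (f b - f a)" by (simp add: power2_eq_square mult.assoc)
    moreover have "D * (f b - f a) = (f b - f a)\<^sup>2 / (b - a)" by (simp add: D_def power2_eq_square)
    ultimately show ?thesis unfolding FTC by simp
  qed
  finally have "(f b - f a)\<^sup>2 \<le> (b - a) * ?I (\<lambda>x. (f' x)\<^sup>2)"
    using \<open>a < b\<close> by (simp add: field_simps)
  moreover have "(\<integral>\<^sup>+x. ennreal ((f' x)\<^sup>2) * indicator {a..b} x \<partial>lborel) = ennreal (?I (\<lambda>x. (f' x)\<^sup>2))"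
    using int[OF cont2] by (subst nn_integral_eq_integral[symmetric]) (auto intro!: nn_integral_cong split: split_indicator)
  ultimately show ?thesis using \<open>a < b\<close>
    by (simp add: ennreal_mult[symmetric] integral_nonneg_AE ennreal_leI)
qed

context centred_gaussian_space
begin

text \<open>
  The argument of Maurey and Pisier.  With \<open>y\<^sub>\<theta> = x(\<omega>) cos \<theta> + x(\<omega>') sin \<theta>\<close>, the difference
  \<open>f(x(\<omega>')) - f(x(\<omega>))\<close> is the integral of \<open>D\<^sub>\<theta> = \<nabla>f(y\<^sub>\<theta>) \<bullet> \<partial>\<^sub>\<theta>y\<^sub>\<theta>\<close> over \<open>[0, \<pi>/2]\<close>.  By rotation
  invariance \<open>E (D\<^sub>\<theta>)\<^sup>2\<close> does not depend on \<open>\<theta>\<close>, and at \<open>\<theta> = 0\<close> it is the double integral on the right.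
  The left-hand side is the expected squared difference, and the factor \<open>\<pi>\<^sup>2/4\<close> is the squared length of
  \<open>[0, \<pi>/2]\<close>.  Integrals of squared derivatives are taken in \<open>[0, \<infinity>]\<close> and may be infinite.
\<close>

theorem poincare_inequality:
  assumes x: "\<And>i. (\<lambda>\<omega>. x \<omega> i) \<in> G" and f: "smooth_seq m f"
    and bounded: "\<And>\<omega>. \<omega> \<in> space M \<Longrightarrow> \<bar>f (x \<omega>)\<bar> \<le> b"
  shows "ennreal (2 * (expectation (\<lambda>\<omega>. (f (x \<omega>))\<^sup>2) - (expectation (\<lambda>\<omega>. f (x \<omega>)))\<^sup>2)) \<le>
    ennreal (pi\<^sup>2 / 4) * (\<integral>\<^sup>+\<omega>. \<integral>\<^sup>+\<omega>'. ennreal ((\<Sum>i<m. pderiv_seq i f (x \<omega>) * x \<omega>' i)\<^sup>2) \<partial>M \<partial>M)"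
proof -
  interpret PP: pair_prob_space M M ..
  note [measurable] = measurable_G[OF x]
  have f_meas [measurable]: "f \<in> borel_measurable borel"
    by (intro borel_measurable_continuous_onI smooth_seq_continuous[OF f])
  have pd_meas [measurable]: "pderiv_seq i f \<in> borel_measurable borel" if "i < m" for i
    by (intro borel_measurable_continuous_onI smooth_seq_continuous_pderiv[OF f that])
  have x_meas [measurable]: "x \<in> M \<rightarrow>\<^sub>M borel"
    by (intro measurable_coordinatewise_then_product) measurable
  define y where "y p \<theta> = (\<lambda>i. cos \<theta> * x (fst p) i + sin \<theta> * x (snd p) i)" for p \<theta>
  define D where "D p \<theta> = (\<Sum>i<m. pderiv_seq i f (y p \<theta>) * (cos \<theta> * x (snd p) i - sin \<theta> * x (fst p) i))" for p \<theta>
  have y_meas [measurable]: "(\<lambda>(p, \<theta>). y p \<theta>) \<in> (M \<Otimes>\<^sub>M M) \<Otimes>\<^sub>M lborel \<rightarrow>\<^sub>M borel"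
    unfolding y_def split_beta by (intro measurable_coordinatewise_then_product) measurable
  have D_meas [measurable]: "(\<lambda>(p, \<theta>). D p \<theta>) \<in> borel_measurable ((M \<Otimes>\<^sub>M M) \<Otimes>\<^sub>M lborel)"
    unfolding D_def split_beta 
  proof (intro borel_measurable_sum borel_measurable_times)
    fix i assume "i \<in> {..<m}"
    then show "(\<lambda>z. pderiv_seq i f (y (fst z) (snd z))) \<in> borel_measurable ((M \<Otimes>\<^sub>M M) \<Otimes>\<^sub>M lborel)"
      using measurable_compose[OF y_meas pd_meas[of i]] by (simp add: split_beta)
  qed measurable
  have pointwise: "ennreal ((f (x (snd p)) - f (x (fst p)))\<^sup>2) \<le>
      ennreal (pi / 2) * (\<integral>\<^sup>+\<theta>. ennreal ((D p \<theta>)\<^sup>2) * indicator {0..pi/2} \<theta> \<partial>lborel)" for p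
  proof -
    have "((\<lambda>\<theta>. f (y p \<theta>)) has_real_derivative D p \<theta>) (at \<theta>)" for \<theta>
      unfolding D_def by (rule smooth_seq_chain_rule[OF f]) (auto simp: y_def intro!: derivative_eq_intros)
    moreover have "continuous_on UNIV (D p)"
      unfolding D_def[abs_def]
      by (intro continuous_intros continuous_on_compose2[OF smooth_seq_continuous_pderiv[OF f]])
         (auto simp: y_def intro!: continuous_intros)
    ultimately show ?thesis using square_increment_le[of 0 "pi/2" "\<lambda>\<theta>. f (y p \<theta>)" "D p"] by (simp add: y_def)
  qed
  define F where "F u = ennreal ((\<Sum>i<m. pderiv_seq i f (\<lambda>i. u (True, i)) * u (False, i))\<^sup>2)" for u :: "bool \<times> nat \<Rightarrow> real"
  have F_meas [measurable]: "F \<in> borel_measurable (\<Pi>\<^sub>M k\<in>UNIV. borel)"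
  proof -
    have "(\<lambda>u i. u (True, i)) \<in> (\<Pi>\<^sub>M k\<in>UNIV. borel) \<rightarrow>\<^sub>M (borel :: (nat \<Rightarrow> real) measure)"
      by (intro measurable_coordinatewise_then_product) measurable
    from measurable_compose[OF this pd_meas] show ?thesis
      unfolding F_def[abs_def] by measurable
  qed
  have rot_meas: "rotated x \<theta> \<in> M \<Otimes>\<^sub>M M \<rightarrow>\<^sub>M (\<Pi>\<^sub>M k\<in>UNIV. borel)" for \<theta>
  proof -
    have "(\<lambda>p. rotated x \<theta> p k) \<in> borel_measurable (M \<Otimes>\<^sub>M M)" for k
      by (cases k; cases "fst k") (auto simp: rotated_def)
    then have "(\<lambda>p. \<lambda>k\<in>UNIV. rotated x \<theta> p k) \<in> M \<Otimes>\<^sub>M M \<rightarrow>\<^sub>M (\<Pi>\<^sub>M k\<in>UNIV. borel)" by (intro measurable_restrict)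
    then show ?thesis by (simp add: restrict_def)
  qed
  have F_rot: "F (rotated x \<theta> p) = ennreal ((D p \<theta>)\<^sup>2)" for \<theta> p
    by (simp add: F_def rotated_def D_def y_def)
  define W where "W = (\<integral>\<^sup>+p. F (rotated x 0 p) \<partial>(M \<Otimes>\<^sub>M M))"
  have push: "(\<integral>\<^sup>+p. F (rotated x \<theta> p) \<partial>(M \<Otimes>\<^sub>M M)) =
      (\<integral>\<^sup>+u. F u \<partial>distr (M \<Otimes>\<^sub>M M) (\<Pi>\<^sub>M k\<in>UNIV. borel) (rotated x \<theta>))" for \<theta>
    using rot_meas F_meas by (intro nn_integral_distr[symmetric]) simp_all
  have D_W: "(\<integral>\<^sup>+p. ennreal ((D p \<theta>)\<^sup>2) \<partial>(M \<Otimes>\<^sub>M M)) = W" for \<theta>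
    unfolding W_def F_rot[symmetric] push distr_rotated[of x \<theta>, OF x] ..
  have W: "W = (\<integral>\<^sup>+\<omega>. \<integral>\<^sup>+\<omega>'. ennreal ((\<Sum>i<m. pderiv_seq i f (x \<omega>) * x \<omega>' i)\<^sup>2) \<partial>M \<partial>M)"
  proof -
    have "(\<lambda>p. F (rotated x 0 p)) \<in> borel_measurable (M \<Otimes>\<^sub>M M)" using measurable_compose[OF rot_meas F_meas] .
    from nn_integral_fst[OF this] show ?thesis unfolding W_def by (simp add: F_def rotated_def)
  qed
  have "(\<integral>\<^sup>+p. ennreal ((f (x (snd p)) - f (x (fst p)))\<^sup>2) \<partial>(M \<Otimes>\<^sub>M M)) \<le>
      (\<integral>\<^sup>+p. ennreal (pi / 2) * (\<integral>\<^sup>+\<theta>. ennreal ((D p \<theta>)\<^sup>2) * indicator {0..pi/2} \<theta> \<partial>lborel) \<partial>(M \<Otimes>\<^sub>M M))"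
    by (intro nn_integral_mono pointwise)
  also have "\<dots> = ennreal (pi / 2) * (\<integral>\<^sup>+p. (\<integral>\<^sup>+\<theta>. ennreal ((D p \<theta>)\<^sup>2) * indicator {0..pi/2} \<theta> \<partial>lborel) \<partial>(M \<Otimes>\<^sub>M M))"
    by (subst nn_integral_cmult) (auto simp: split_beta')
  also have "(\<integral>\<^sup>+p. (\<integral>\<^sup>+\<theta>. ennreal ((D p \<theta>)\<^sup>2) * indicator {0..pi/2} \<theta> \<partial>lborel) \<partial>(M \<Otimes>\<^sub>M M)) =
      (\<integral>\<^sup>+\<theta>. (\<integral>\<^sup>+p. ennreal ((D p \<theta>)\<^sup>2) * indicator {0..pi/2} \<theta> \<partial>(M \<Otimes>\<^sub>M M)) \<partial>lborel)"
  proof -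
    interpret Q: pair_sigma_finite "M \<Otimes>\<^sub>M M" "lborel :: real measure" ..
    show ?thesis by (rule Q.Fubini'[symmetric]) (simp add: split_beta')
  qed
  also have "\<dots> = (\<integral>\<^sup>+\<theta>. W * indicator {0..pi/2} \<theta> \<partial>lborel)"
    by (intro nn_integral_cong) (simp add: nn_integral_multc D_W)
  also have "\<dots> = ennreal (pi / 2) * W"
    by (subst nn_integral_cmult) (auto simp: mult.commute)
  also have "ennreal (pi / 2) * (ennreal (pi / 2) * W) = ennreal (pi\<^sup>2 / 4) * W"
    by (simp add: mult.assoc[symmetric] ennreal_mult[symmetric] power2_eq_square)
  finally have main: "(\<integral>\<^sup>+p. ennreal ((f (x (snd p)) - f (x (fst p)))\<^sup>2) \<partial>(M \<Otimes>\<^sub>M M)) \<le> ennreal (pi\<^sup>2 / 4) * W" .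
  define g where "g \<omega> = f (x \<omega>)" for \<omega>
  have [measurable]: "g \<in> borel_measurable M" unfolding g_def[abs_def] by measurable
  have g: "\<And>\<omega>. \<omega> \<in> space M \<Longrightarrow> \<bar>g \<omega>\<bar> \<le> b" using bounded by (simp add: g_def)
  have ig: "integrable M g" by (rule integrable_const_bound[where B = b]) (use g in auto)
  have ig2: "integrable M (\<lambda>\<omega>. (g \<omega>)\<^sup>2)"
  proof (rule integrable_const_bound[where B = "b\<^sup>2"])
    have "(g \<omega>)\<^sup>2 \<le> b\<^sup>2" if "\<omega> \<in> space M" for \<omega>
      using g[OF that] by (intro abs_le_square_iff[THEN iffD1]) linarith
    then show "AE \<omega> in M. norm ((g \<omega>)\<^sup>2) \<le> b\<^sup>2" by (auto intro!: AE_I2)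
  qed measurable
  have ipair: "integrable (M \<Otimes>\<^sub>M M) (\<lambda>p. (g (snd p) - g (fst p))\<^sup>2)"
  proof (rule PP.P.integrable_const_bound[where B = "(2 * b)\<^sup>2"])
    have "(g \<omega>' - g \<omega>)\<^sup>2 \<le> (2 * b)\<^sup>2" if "\<omega> \<in> space M" "\<omega>' \<in> space M" for \<omega> \<omega>'
      using g[OF that(1)] g[OF that(2)] by (intro abs_le_square_iff[THEN iffD1]) linarith
    then show "AE p in M \<Otimes>\<^sub>M M. norm ((g (snd p) - g (fst p))\<^sup>2) \<le> (2 * b)\<^sup>2"
      by (auto simp: space_pair_measure intro!: AE_I2)
  qed measurable
  have "(\<integral>\<^sup>+p. ennreal ((g (snd p) - g (fst p))\<^sup>2) \<partial>(M \<Otimes>\<^sub>M M)) = ennreal (LINT p|(M \<Otimes>\<^sub>M M). (g (snd p) - g (fst p))\<^sup>2)"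
    using ipair by (rule nn_integral_eq_integral) simp
  also have "(LINT p|(M \<Otimes>\<^sub>M M). (g (snd p) - g (fst p))\<^sup>2) = (LINT \<omega>|M. LINT \<omega>'|M. (g \<omega>' - g \<omega>)\<^sup>2)"
    using PP.integral_fst'[OF ipair] by simp
  also have "\<dots> = (LINT \<omega>|M. expectation (\<lambda>\<omega>. (g \<omega>)\<^sup>2) - 2 * g \<omega> * expectation g + (g \<omega>)\<^sup>2)"
    using ig ig2 by (intro Bochner_Integration.integral_cong refl) (simp add: power2_diff algebra_simps prob_space)
  also have "\<dots> = 2 * (expectation (\<lambda>\<omega>. (g \<omega>)\<^sup>2) - (expectation g)\<^sup>2)"
    using ig ig2 by (simp add: power2_eq_square algebra_simps prob_space)
  finally show ?thesis using main W by (simp add: g_def[abs_def])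
qed

end

section \<open>Young's inequality for singular kernels on the torus\<close>

text \<open>
  For \<open>|t| < 1\<close> this is the distance from \<open>t\<close> to the integers.
\<close>

definition near_int_dist :: "real \<Rightarrow> real" where
  "near_int_dist t = min \<bar>t\<bar> (min \<bar>t - 1\<bar> \<bar>t + 1\<bar>)"

text \<open>
  The value \<open>\<infinity>\<close> at the singularities makes the pointwise bounds below hold without exceptional null
  sets.
\<close>

definition coord_singularity :: "real \<Rightarrow> real \<Rightarrow> ennreal" where
  "coord_singularity \<alpha> t = (if near_int_dist t = 0 then \<infinity> else ennreal (near_int_dist t powr - \<alpha>))"

text \<open>
  An explicit measurable majorant of \<open>|z|\<^bsup>-n\<alpha>\<^esup>\<close> on the cube \<open>(-1, 1)\<^sup>n\<close>.  The geodesic distance dominates the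
  distance in each coordinate, hence also the geometric mean of these distances; the product form lets Tonelli's
  theorem reduce integrability to one dimension.
\<close>

definition singular_kernel :: "real \<Rightarrow> real^'n \<Rightarrow> ennreal" where
  "singular_kernel \<alpha> z = (\<Prod>b\<in>Basis. coord_singularity \<alpha> (z \<bullet> b))"

lemma near_int_dist_nonneg: "0 \<le> near_int_dist t" by (simp add: near_int_dist_def)

lemma coord_singularity_nonzero: "coord_singularity \<alpha> t \<noteq> 0"
  using near_int_dist_nonneg[of t] by (auto simp: coord_singularity_def ennreal_eq_0_iff not_le)

lemma measurable_coord_singularity [measurable]: "coord_singularity \<alpha> \<in> borel_measurable borel"
  unfolding coord_singularity_def[abs_def] near_int_dist_def by measurable

lemma measurable_singular_kernel [measurable]: "singular_kernel \<alpha> \<in> borel_measurable borel"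
  unfolding singular_kernel_def[abs_def] by measurable

lemma singular_kernel_eq_top: "b \<in> Basis \<Longrightarrow> near_int_dist (z \<bullet> b) = 0 \<Longrightarrow> singular_kernel \<alpha> z = \<infinity>"
  unfolding singular_kernel_def
  by (subst prod.remove[of Basis b]) (auto simp: coord_singularity_def ennreal_top_mult coord_singularity_nonzero)

lemma singular_kernel_eq_ennreal:
  assumes "\<And>b. b \<in> Basis \<Longrightarrow> near_int_dist (z \<bullet> b) \<noteq> 0"
  shows "singular_kernel \<alpha> z = ennreal (\<Prod>b\<in>Basis. near_int_dist (z \<bullet> b) powr - \<alpha>)"
  unfolding singular_kernel_def using assms by (simp add: coord_singularity_def prod_ennreal)

lemma nn_integral_abs_powr_finite:
  assumes "0 < \<beta>" "\<beta> < 1"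
  shows "(\<integral>\<^sup>+t. ennreal (\<bar>t\<bar> powr - \<beta>) * indicator {-2..2} t \<partial>lborel) < \<infinity>"
proof -
  have "((\<lambda>t. t powr - \<beta>) has_integral (2 powr (- \<beta> + 1) / (- \<beta> + 1))) {0..2}"
    using assms by (intro has_integral_powr_from_0) auto
  from nn_integral_has_integral_lebesgue[OF _ this]
  have fin: "(\<integral>\<^sup>+t. ennreal (indicator {0..2} t * t powr - \<beta>) \<partial>lborel) < \<infinity>" (is "?J < \<infinity>")
    by (simp add: nn_integral_completion)
  have "(\<integral>\<^sup>+t. ennreal (\<bar>t\<bar> powr - \<beta>) * indicator {-2..2} t \<partial>lborel) \<le>
      (\<integral>\<^sup>+t. ennreal (indicator {0..2} t * t powr - \<beta>) + ennreal (indicator {0..2} (0 + (-1) * t) * (0 + (-1) * t) powr - \<beta>) \<partial>lborel)"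
    by (intro nn_integral_mono) (auto split: split_indicator simp: abs_if)
  also have "\<dots> = ?J + (\<integral>\<^sup>+t. ennreal (indicator {0..2} (0 + (-1) * t) * (0 + (-1) * t) powr - \<beta>) \<partial>lborel)"
    by (intro nn_integral_add) auto
  also have "(\<integral>\<^sup>+t. ennreal (indicator {0..2} (0 + (-1) * t) * (0 + (-1) * t) powr - \<beta>) \<partial>lborel) = ?J"
    using nn_integral_real_affine[of "\<lambda>t. ennreal (indicator {0..2} t * t powr - \<beta>)" "-1" 0] by simp
  finally show ?thesis using fin by (simp add: order_le_less_trans)
qed

lemma nn_integral_coord_singularity_finite:
  assumes "0 < \<beta>" "\<beta> < 1"
  shows "(\<integral>\<^sup>+t. coord_singularity \<beta> t * indicator {-1<..<1} t \<partial>lborel) < \<infinity>"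
proof -
  define g where "g t = ennreal (\<bar>t\<bar> powr - \<beta>) * indicator {-2..2} t" for t :: real
  have [measurable]: "g \<in> borel_measurable borel" unfolding g_def[abs_def] by measurable
  have fin: "(\<integral>\<^sup>+t. g t \<partial>lborel) < \<infinity>" using nn_integral_abs_powr_finite[OF assms] by (simp add: g_def)
  have shift: "(\<integral>\<^sup>+t. g (t - 1) \<partial>lborel) = (\<integral>\<^sup>+t. g t \<partial>lborel)"
      "(\<integral>\<^sup>+t. g (t + 1) \<partial>lborel) = (\<integral>\<^sup>+t. g t \<partial>lborel)"
    using nn_integral_real_affine[of g 1 "-1"] nn_integral_real_affine[of g 1 1] by (simp_all add: add.commute)
  have "(\<integral>\<^sup>+t. coord_singularity \<beta> t * indicator {-1<..<1} t \<partial>lborel) \<le> (\<integral>\<^sup>+t. g t + (g (t - 1) + g (t + 1)) \<partial>lborel)"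
  proof (intro nn_integral_mono_AE)
    have "AE t in lborel. (t::real) \<noteq> 0" by (rule AE_lborel_singleton)
    then show "AE t in lborel. coord_singularity \<beta> t * indicator {-1<..<1} t \<le> g t + (g (t - 1) + g (t + 1))"
    proof eventually_elim
      case (elim t)
      show ?case
      proof (cases "t \<in> {-1<..<1}")
        case True
        then have t: "near_int_dist t \<noteq> 0" using elim by (auto simp: near_int_dist_def min_def)
        have "near_int_dist t = \<bar>t\<bar> \<or> near_int_dist t = \<bar>t - 1\<bar> \<or> near_int_dist t = \<bar>t + 1\<bar>"
          by (auto simp: near_int_dist_def min_def)
        then have "ennreal (near_int_dist t powr - \<beta>) = g t \<or> ennreal (near_int_dist t powr - \<beta>) = g (t - 1) \<or> ennreal (near_int_dist t powr - \<beta>) = g (t + 1)"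
          using True by (auto simp: g_def)
        then show ?thesis using True t by (auto simp: coord_singularity_def add.commute add_increasing add_increasing2)
      qed simp
    qed
  qed
  also have "\<dots> < \<infinity>"
    using fin by (simp add: nn_integral_add shift)
  finally show ?thesis .
qed

lemma nn_integral_singular_kernel_finite:
  assumes "0 < \<beta>" "\<beta> < 1"
  shows "(\<integral>\<^sup>+z. singular_kernel \<beta> z * indicator {z. \<forall>b\<in>Basis. \<bar>z \<bullet> b\<bar> < 1} z \<partial>(lborel :: (real^'n) measure)) < \<infinity>"
proof -
  have "singular_kernel \<beta> z * indicator {z. \<forall>b\<in>Basis. \<bar>z \<bullet> b\<bar> < 1} z =
      (\<Prod>b\<in>Basis. coord_singularity \<beta> (z \<bullet> b) * indicator {-1<..<1} (z \<bullet> b))" for z :: "real^'n"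
  proof (cases "\<forall>b\<in>Basis. \<bar>z \<bullet> b\<bar> < 1")
    case True
    then show ?thesis by (auto simp: singular_kernel_def abs_less_iff intro!: prod.cong)
  next
    case False
    then obtain b where "b \<in> Basis" "\<not> \<bar>z \<bullet> b\<bar> < 1" by blast
    then have "\<exists>b\<in>Basis. coord_singularity \<beta> (z \<bullet> b) * indicator {-1<..<1} (z \<bullet> b) = 0"
      by (intro bexI[of _ b]) (auto simp: indicator_def abs_less_iff)
    then have "(\<Prod>b\<in>Basis. coord_singularity \<beta> (z \<bullet> b) * indicator {-1<..<1} (z \<bullet> b)) = 0"
      by (intro prod_zero) auto
    moreover have "indicator {z. \<forall>b\<in>Basis. \<bar>z \<bullet> b\<bar> < 1} z = (0 :: ennreal)"
      using False by (intro indicator_simps(2)) blast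
    ultimately show ?thesis by simp
  qed
  moreover have "(\<integral>\<^sup>+z. (\<Prod>b\<in>Basis. coord_singularity \<beta> (z \<bullet> b) * indicator {-1<..<1} (z \<bullet> b)) \<partial>(lborel :: (real^'n) measure)) =
      (\<Prod>b\<in>(Basis :: (real^'n) set). (\<integral>\<^sup>+t. coord_singularity \<beta> t * indicator {-1<..<1} t \<partial>lborel))"
    by (rule nn_integral_lborel_prod) auto
  ultimately show ?thesis
    using nn_integral_coord_singularity_finite[OF assms] by (simp add: power_less_top_ennreal)
qed

text \<open>
  The pointwise inequality behind Young's convolution inequality.  The left-hand side is the weighted
  geometric mean of the three summands with weights \<open>1 - 2/q\<close>, \<open>1/q\<close> and \<open>1/q\<close>, which is at
  most their sum.
\<close>

lemma three_factor_bound_real: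
  fixes a b h :: real
  assumes "2 < q" "1 / q + 1 / p = 1" "0 \<le> a" "0 \<le> b" "0 \<le> h"
  shows "a * h * b \<le> a powr p * b powr p + a powr p * h powr (q / 2) + b powr p * h powr (q / 2)"
proof (cases "a = 0 \<or> b = 0 \<or> h = 0")
  case True
  then show ?thesis by auto
next
  case False
  then have pos: "0 < a" "0 < b" "0 < h" using assms by auto
  have p: "p \<noteq> 0" using assms by auto
  have pq: "p * (1 - 1 / q) = 1" using assms p by (simp add: field_simps)
  let ?u = "a powr p * b powr p" and ?v = "a powr p * h powr (q / 2)" and ?w = "b powr p * h powr (q / 2)"
  let ?s = "?u + ?v + ?w"
  have "a * h * b = ?u powr (1 - 2 / q) * ?v powr (1 / q) * ?w powr (1 / q)"
  proof -
    have "?u powr (1 - 2 / q) * ?v powr (1 / q) * ?w powr (1 / q) =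
       (a powr (p * (1 - 2 / q)) * a powr (p * (1 / q))) * (b powr (p * (1 - 2 / q)) * b powr (p * (1 / q))) *
       (h powr (q / 2 * (1 / q)) * h powr (q / 2 * (1 / q)))"
      using pos by (simp add: powr_mult powr_powr)
    also have "\<dots> = a powr (p * (1 - 2 / q) + p * (1 / q)) * b powr (p * (1 - 2 / q) + p * (1 / q)) *
       h powr (q / 2 * (1 / q) + q / 2 * (1 / q))"
      by (simp only: powr_add)
    also have "p * (1 - 2 / q) + p * (1 / q) = 1" using pq by (simp add: algebra_simps)
    also have "q / 2 * (1 / q) + q / 2 * (1 / q) = 1" using assms by simp
    finally show ?thesis using pos by simp
  qed
  also have "\<dots> \<le> ?s powr (1 - 2 / q) * ?s powr (1 / q) * ?s powr (1 / q)"
    using assms by (intro mult_mono powr_mono2) auto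
  also have "\<dots> = ?s powr (1 - 2 / q + 1 / q + 1 / q)" by (simp only: powr_add)
  also have "\<dots> = ?s" using pos by (simp add: add_nonneg_nonneg)
  finally show ?thesis .
qed

lemma three_factor_bound:
  fixes a b :: real and z :: "real^'n"
  assumes "2 < q" "1 / q + 1 / p = 1" "0 \<le> a" "0 \<le> b"
  shows "ennreal a * singular_kernel \<alpha> z * ennreal b \<le>
    ennreal (a powr p * b powr p) + ennreal (a powr p) * singular_kernel (\<alpha> * (q / 2)) z + ennreal (b powr p) * singular_kernel (\<alpha> * (q / 2)) z"
proof (cases "\<exists>b\<in>Basis. near_int_dist (z \<bullet> b) = 0")
  case True
  then have "singular_kernel \<alpha> z = \<infinity>" "singular_kernel (\<alpha> * (q / 2)) z = \<infinity>" using singular_kernel_eq_top by blast+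
  then show ?thesis using assms
    by (cases "a = 0 \<or> b = 0") (auto simp: ennreal_mult_top)
next
  case False
  define h where "h = (\<Prod>b\<in>Basis. near_int_dist (z \<bullet> b) powr - \<alpha>)"
  have "h \<ge> 0" unfolding h_def by (intro prod_nonneg) auto
  have h: "singular_kernel \<alpha> z = ennreal h" unfolding h_def using False by (intro singular_kernel_eq_ennreal) auto
  have "h powr (q / 2) = (\<Prod>b\<in>Basis. near_int_dist (z \<bullet> b) powr - (\<alpha> * (q / 2)))"
    unfolding h_def by (subst prod_powr_distrib) (auto simp: powr_powr)
  then have "singular_kernel (\<alpha> * (q / 2)) z = ennreal (h powr (q / 2))"
    using False by (subst singular_kernel_eq_ennreal) auto
  then show ?thesis
    using three_factor_bound_real[OF assms \<open>h \<ge> 0\<close>] assms \<open>h \<ge> 0\<close> h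
    by (simp add: ennreal_mult[symmetric] ennreal_plus[symmetric] ennreal_leI del: ennreal_plus)
qed

lemma torus_abs_powr_le_singular_kernel:
  fixes z :: "real^'n"
  assumes "0 < \<gamma>" "\<And>b. b \<in> Basis \<Longrightarrow> \<bar>z \<bullet> b\<bar> < 1"
  shows "ennreal (torus_abs z powr - \<gamma>) \<le> singular_kernel (\<gamma> / real CARD('n)) z"
proof (cases "\<exists>b\<in>Basis. near_int_dist (z \<bullet> b) = 0")
  case True
  then show ?thesis using singular_kernel_eq_top[of _ z] by (metis top_greatest infinity_ennreal_def)
next
  case False
  have ne: "(int_lattice :: (real^'n) set) \<noteq> {}" by (auto simp: int_lattice_def intro: exI[of _ 0])
  have le: "near_int_dist (z \<bullet> b) \<le> torus_abs z" if b: "b \<in> Basis" for b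
    unfolding torus_abs_def infdist_notempty[OF ne]
  proof (rule cINF_greatest[OF ne])
    fix w :: "real^'n" assume w: "w \<in> int_lattice"
    obtain i where i: "b = axis i 1" using b by (auto simp: Basis_vec_def)
    then have "w \<bullet> b \<in> \<int>" using w by (auto simp: int_lattice_def inner_axis)
    then obtain m where m: "w \<bullet> b = of_int m" by (auto elim: Ints_cases)
    have "near_int_dist (z \<bullet> b) \<le> \<bar>z \<bullet> b - w \<bullet> b\<bar>"
    proof -
      have "m = 0 \<or> m = 1 \<or> m = -1 \<or> real_of_int m \<ge> 2 \<or> real_of_int m \<le> -2" by linarith
      then show ?thesis using assms(2)[OF b] m
        by (auto simp: near_int_dist_def min_def abs_if split: if_splits)
    qed
    also have "\<dots> \<le> dist z w"
      using Basis_le_norm[OF b, of "z - w"] by (simp add: dist_norm inner_diff_left)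
    finally show "near_int_dist (z \<bullet> b) \<le> dist z w" .
  qed
  have pos: "0 < near_int_dist (z \<bullet> b)" if "b \<in> Basis" for b
    using False that near_int_dist_nonneg[of "z \<bullet> b"] by force
  have tpos: "0 < torus_abs z" using pos le SOME_Basis by (meson less_le_trans)
  let ?n = "real CARD('n)"
  have "torus_abs z powr - \<gamma> = (\<Prod>b\<in>(Basis :: (real^'n) set). torus_abs z powr - (\<gamma> / ?n))"
    using tpos by (simp add: powr_realpow[symmetric] powr_powr)
  also have "\<dots> \<le> (\<Prod>b\<in>Basis. near_int_dist (z \<bullet> b) powr - (\<gamma> / ?n))"
    using assms(1) pos le by (intro prod_mono conjI powr_mono2') auto
  finally show ?thesis
    using False by (subst singular_kernel_eq_ennreal) (auto intro: ennreal_leI)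
qed

lemma singular_kernel_lattice:
  fixes z :: "real^'n"
  assumes "z \<in> int_lattice" "\<And>b. b \<in> Basis \<Longrightarrow> \<bar>z \<bullet> b\<bar> < 1"
  shows "singular_kernel \<alpha> z = \<infinity>"
proof -
  obtain b :: "real^'n" where b: "b \<in> Basis" using SOME_Basis by blast
  obtain i where i: "b = axis i 1" using b by (auto simp: Basis_vec_def)
  then have "z \<bullet> b \<in> \<int>" using assms(1) by (auto simp: int_lattice_def inner_axis)
  then have "z \<bullet> b = 0" using assms(2)[OF b] by (metis Ints_nonzero_abs_less1)
  then show ?thesis using b by (intro singular_kernel_eq_top[of b]) (auto simp: near_int_dist_def)
qed

lemma kernel_le_singular_kernel:
  fixes C :: "real^'n \<Rightarrow> 'e::euclidean_space \<Rightarrow>\<^sub>L 'e"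
  assumes "0 < \<gamma>" "bdd_above ((\<lambda>x. torus_abs x powr \<gamma> * norm (C x)) ` (- int_lattice))"
  obtains c where "0 < c" "\<And>z. (\<And>b. b \<in> Basis \<Longrightarrow> \<bar>z \<bullet> b\<bar> < 1) \<Longrightarrow>
    ennreal (norm (C z)) \<le> ennreal c * singular_kernel (\<gamma> / real CARD('n)) z"
proof -
  obtain c0 where c0: "\<And>x. x \<notin> int_lattice \<Longrightarrow> torus_abs x powr \<gamma> * norm (C x) \<le> c0"
    using assms(2) by (auto simp: bdd_above_def)
  define c where "c = max c0 1"
  show ?thesis
  proof (rule that[of c])
    show c: "0 < c" by (simp add: c_def)
    fix z :: "real^'n" assume z: "\<And>b. b \<in> Basis \<Longrightarrow> \<bar>z \<bullet> b\<bar> < 1"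
    show "ennreal (norm (C z)) \<le> ennreal c * singular_kernel (\<gamma> / real CARD('n)) z"
    proof (cases "z \<in> int_lattice")
      case True
      then show ?thesis using singular_kernel_lattice[OF _ z] c by (simp add: ennreal_mult_top)
    next
      case False
      have ne: "(int_lattice :: (real^'n) set) \<noteq> {}" by (auto simp: int_lattice_def intro: exI[of _ 0])
      have "closed (int_lattice :: (real^'n) set)"
      proof -
        have "int_lattice = (\<Inter>i. (\<lambda>z :: real^'n. z $ i) -` \<int>)" by (auto simp: int_lattice_def)
        moreover have "closed (\<Inter>i. (\<lambda>z :: real^'n. z $ i) -` \<int>)"
          by (intro closed_INT ballI closed_vimage closed_Ints continuous_intros)
        ultimately show ?thesis by simp
      qed
      then have "0 < torus_abs z" unfolding torus_abs_def
        using False ne infdist_pos_not_in_closed by blast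
      then have "norm (C z) \<le> c * torus_abs z powr - \<gamma>"
        using c0[OF False] by (auto simp: c_def powr_minus field_simps)
      then have "ennreal (norm (C z)) \<le> ennreal c * ennreal (torus_abs z powr - \<gamma>)"
        using c by (simp add: ennreal_mult[symmetric] ennreal_leI)
      also have "\<dots> \<le> ennreal c * singular_kernel (\<gamma> / real CARD('n)) z"
        by (intro mult_left_mono torus_abs_powr_le_singular_kernel assms z) auto
      finally show ?thesis .
    qed
  qed
qed

text \<open>
  The fundamental domain on which the Haar measure of the torus lives.
\<close>

abbreviation unit_cube :: "(real^'n) set" where
  "unit_cube \<equiv> {x. \<forall>i. 0 \<le> x $ i \<and> x $ i < 1}"

lemma unit_cube_borel: "unit_cube \<in> sets borel"
  by measurable

lemma space_torus [simp]: "space torus = unit_cube"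
  by (simp add: torus_def space_restrict_space)

lemma measurable_torusI [measurable (raw)]: "f \<in> borel \<rightarrow>\<^sub>M N \<Longrightarrow> f \<in> torus \<rightarrow>\<^sub>M N"
  unfolding torus_def by (intro measurable_restrict_space1) simp

text \<open>
  Reducing measurability on the torus to Borel measurability, also for integrands in two variables.
\<close>

lemma measurable_pair_torusI [measurable (raw)]:
  "f \<in> borel \<Otimes>\<^sub>M borel \<rightarrow>\<^sub>M N \<Longrightarrow> f \<in> torus \<Otimes>\<^sub>M torus \<rightarrow>\<^sub>M N"
  "f \<in> borel \<Otimes>\<^sub>M borel \<rightarrow>\<^sub>M N \<Longrightarrow> f \<in> borel \<Otimes>\<^sub>M torus \<rightarrow>\<^sub>M N"
proof -
  have id: "(\<lambda>x. x) \<in> torus \<rightarrow>\<^sub>M borel" by (rule measurable_torusI) simp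
  have "(\<lambda>p. (fst p, snd p)) \<in> torus \<Otimes>\<^sub>M torus \<rightarrow>\<^sub>M borel \<Otimes>\<^sub>M borel"
    by (intro measurable_Pair measurable_compose[OF measurable_fst id] measurable_compose[OF measurable_snd id])
  from measurable_compose[OF this, of f N]
  show "f \<in> borel \<Otimes>\<^sub>M borel \<rightarrow>\<^sub>M N \<Longrightarrow> f \<in> torus \<Otimes>\<^sub>M torus \<rightarrow>\<^sub>M N" by simp
  have "(\<lambda>p. (fst p, snd p)) \<in> borel \<Otimes>\<^sub>M torus \<rightarrow>\<^sub>M borel \<Otimes>\<^sub>M borel"
    by (intro measurable_Pair measurable_fst measurable_compose[OF measurable_snd id])
  from measurable_compose[OF this, of f N]
  show "f \<in> borel \<Otimes>\<^sub>M borel \<rightarrow>\<^sub>M N \<Longrightarrow> f \<in> borel \<Otimes>\<^sub>M torus \<rightarrow>\<^sub>M N" by simp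
qed

lemma nn_integral_torus: "(\<integral>\<^sup>+x. f x \<partial>torus) = (\<integral>\<^sup>+x. f x * indicator unit_cube x \<partial>lborel)"
  unfolding torus_def by (rule nn_integral_restrict_space) (use unit_cube_borel in auto)

lemma finite_measure_torus: "finite_measure (torus :: (real^'n) measure)"
proof
  have "emeasure torus (space (torus :: (real^'n) measure)) = emeasure lborel (unit_cube :: (real^'n) set)"
    unfolding space_torus unfolding torus_def using unit_cube_borel by (subst emeasure_restrict_space) auto
  also have "\<dots> \<le> emeasure lborel (cbox 0 (\<chi> i. 1) :: (real^'n) set)"
    by (intro emeasure_mono) (auto simp: mem_box_cart less_imp_le)
  also have "\<dots> < \<infinity>" by (rule emeasure_lborel_cbox_finite)
  finally show "emeasure torus (space (torus :: (real^'n) measure)) \<noteq> \<infinity>" by simp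
qed

text \<open>
  Differences of points of the unit cube have coordinates in \<open>(-1, 1)\<close>, so enlarging the domain of
  integration to that cube removes the dependence on \<open>x\<close>.
\<close>

lemma nn_integral_torus_singular_kernel_le:
  fixes x :: "real^'n"
  assumes x: "x \<in> unit_cube"
  shows "(\<integral>\<^sup>+y. singular_kernel \<beta> (x - y) \<partial>torus) \<le>
    (\<integral>\<^sup>+z. singular_kernel \<beta> z * indicator {z. \<forall>b\<in>Basis. \<bar>z \<bullet> b\<bar> < 1} z \<partial>(lborel :: (real^'n) measure))"
proof -
  let ?B = "{z :: real^'n. \<forall>b\<in>Basis. \<bar>z \<bullet> b\<bar> < 1}"
  have diff: "x - y \<in> ?B" if "y \<in> unit_cube" for y
    using x that by (auto simp: Basis_vec_def inner_axis abs_less_iff algebra_simps) (smt (verit, ccfv_SIG))+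
  have "(\<integral>\<^sup>+y. singular_kernel \<beta> (x - y) \<partial>torus) = (\<integral>\<^sup>+y. singular_kernel \<beta> (x - y) * indicator unit_cube y \<partial>lborel)"
    by (rule nn_integral_torus)
  also have "\<dots> \<le> (\<integral>\<^sup>+y. singular_kernel \<beta> (x - y) * indicator ?B (x - y) \<partial>lborel)"
    using diff by (intro nn_integral_mono mult_left_mono) (auto simp: indicator_def)
  also have "\<dots> = (\<integral>\<^sup>+z. singular_kernel \<beta> z * indicator ?B z \<partial>distr lborel borel (\<lambda>y. x - y))"
    by (subst nn_integral_distr) auto
  also have "distr lborel borel (\<lambda>y. x - y) = lborel"
    using lborel_affine[of "-1" x] by (simp add: density_1)
  finally show ?thesis .
qed

text \<open>
  If \<open>f\<close> is not integrable, its Bochner integral is \<open>0\<close> by convention.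
\<close>

lemma norm_integral_le_nn_integral:
  fixes f :: "'a \<Rightarrow> 'b::{banach, second_countable_topology}"
  shows "ennreal (norm (integral\<^sup>L M f)) \<le> (\<integral>\<^sup>+x. ennreal (norm (f x)) \<partial>M)"
  by (cases "integrable M f") (auto simp: integral_norm_bound_ennreal not_integrable_integral_eq)

text \<open>
  Young's convolution inequality for the quadratic form of \<open>C\<close>.  Integrating
  \<open>three_factor_bound\<close> bounds the form by a constant on the unit sphere of \<open>L\<^sup>p\<close>, and homogeneity does
  the rest.  Passing to nonnegative integrals first, and then from \<open>C\<close> to its measurable majorant, avoids
  any question about the measurability of the operator norm of \<open>C\<close>.
\<close>

theorem bilinear_form_le_Lp_norm:
  fixes C :: "real^'n \<Rightarrow> 'e::euclidean_space \<Rightarrow>\<^sub>L 'e"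
  assumes \<gamma>: "0 < \<gamma>" and C: "bdd_above ((\<lambda>x. torus_abs x powr \<gamma> * norm (C x)) ` (- int_lattice))"
    and q: "2 < q" "\<gamma> * q < 2 * real CARD('n)" and p: "1 / q + 1 / p = 1"
  obtains K where "0 \<le> K"
    and "\<And>\<phi>. continuous_on UNIV \<phi> \<Longrightarrow> \<bar>LINT x|torus. \<phi> x \<bullet> convolve C \<phi> x\<bar> \<le> K * (Lp_norm p \<phi>)\<^sup>2"
proof -
  obtain c where c: "0 < c" and C_le: "\<And>z. (\<And>b. b \<in> Basis \<Longrightarrow> \<bar>z \<bullet> b\<bar> < 1) \<Longrightarrow>
      ennreal (norm (C z)) \<le> ennreal c * singular_kernel (\<gamma> / real CARD('n)) z"
    using kernel_le_singular_kernel[OF \<gamma> C] by blast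
  define \<alpha> where "\<alpha> = \<gamma> / real CARD('n)"
  define \<beta> where "\<beta> = \<alpha> * (q / 2)"
  have \<beta>: "0 < \<beta>" "\<beta> < 1" using \<gamma> q by (auto simp: \<alpha>_def \<beta>_def field_simps)
  have "0 < 1 / p"
  proof -
    have "1 / q < 1" using q by simp
    then show ?thesis using p by linarith
  qed
  then have p0: "0 < p" by (simp only: zero_less_divide_1_iff)
  let ?D = "\<integral>\<^sup>+z. singular_kernel \<beta> z * indicator {z. \<forall>b\<in>Basis. \<bar>z \<bullet> b\<bar> < 1} z \<partial>(lborel :: (real^'n) measure)"
  define D where "D = enn2real ?D"
  have D: "0 \<le> D" "?D = ennreal D"
    using nn_integral_singular_kernel_finite[OF \<beta>, where 'n = 'n] by (simp_all add: D_def less_top)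
  interpret T: finite_measure "torus :: (real^'n) measure" by (rule finite_measure_torus)
  interpret TT: pair_sigma_finite "torus :: (real^'n) measure" "torus :: (real^'n) measure" ..
  show ?thesis
  proof (rule that[of "c * (1 + 2 * D)"])
    show "0 \<le> c * (1 + 2 * D)" using c D by simp
    fix \<phi> :: "real^'n \<Rightarrow> 'e" assume cont: "continuous_on UNIV \<phi>"
    have [measurable]: "\<phi> \<in> borel_measurable borel" using cont by (rule borel_measurable_continuous_onI)
    define A where "A x = norm (\<phi> x)" for x
    have A_nonneg: "0 \<le> A x" for x by (simp add: A_def)
    have [measurable]: "A \<in> borel_measurable borel" unfolding A_def[abs_def] by measurable
    obtain B where B: "\<And>x. x \<in> unit_cube \<Longrightarrow> A x \<le> B"
    proof -
      have "compact (\<phi> ` cbox 0 (\<chi> i. 1))"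
        by (intro compact_continuous_image continuous_on_subset[OF cont]) auto
      then obtain B where "\<And>y. y \<in> \<phi> ` cbox 0 (\<chi> i. 1) \<Longrightarrow> norm y \<le> B"
        using compact_imp_bounded bounded_iff by metis
      then show ?thesis by (intro that[of B]) (auto simp: A_def mem_box_cart less_imp_le)
    qed
    define N where "N = (LINT x|torus. A x powr p)"
    have "integrable torus (\<lambda>x. A x powr p)"
      using B p0 A_nonneg
      by (intro T.integrable_const_bound[where B = "B powr p"] AE_I2) (auto intro!: powr_mono2)
    then have N: "(\<integral>\<^sup>+x. ennreal (A x powr p) \<partial>torus) = ennreal N"
      unfolding N_def by (rule nn_integral_eq_integral) auto
    have "0 \<le> N" by (simp add: N_def)
    define I where "I = \<bar>LINT x|torus. \<phi> x \<bullet> convolve C \<phi> x\<bar>"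
    have conv_le: "ennreal (norm (convolve C \<phi> x)) \<le> (\<integral>\<^sup>+y. ennreal c * (singular_kernel \<alpha> (x - y) * ennreal (A y)) \<partial>torus)"
      if x: "x \<in> unit_cube" for x
    proof -
      have "ennreal (norm (convolve C \<phi> x)) \<le> (\<integral>\<^sup>+y. ennreal (norm (blinfun_apply (C (x - y)) (\<phi> y))) \<partial>torus)"
        unfolding convolve_def by (rule norm_integral_le_nn_integral)
      also have "\<dots> \<le> (\<integral>\<^sup>+y. ennreal c * (singular_kernel \<alpha> (x - y) * ennreal (A y)) \<partial>torus)"
      proof (rule nn_integral_mono)
        fix y :: "real^'n" assume "y \<in> space torus"
        then have "\<bar>(x - y) \<bullet> b\<bar> < 1" if "b \<in> Basis" for b
          using x that by (auto simp: Basis_vec_def inner_axis abs_less_iff algebra_simps) (smt (verit, ccfv_SIG))+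
        then have "ennreal (norm (C (x - y))) \<le> ennreal c * singular_kernel \<alpha> (x - y)" unfolding \<alpha>_def by (rule C_le)
        then have "ennreal (norm (C (x - y))) * ennreal (A y) \<le> ennreal c * singular_kernel \<alpha> (x - y) * ennreal (A y)"
          by (rule mult_right_mono) simp
        moreover have "ennreal (norm (blinfun_apply (C (x - y)) (\<phi> y))) \<le> ennreal (norm (C (x - y))) * ennreal (A y)"
          by (simp add: A_def ennreal_mult[symmetric] ennreal_leI norm_blinfun)
        ultimately show "ennreal (norm (blinfun_apply (C (x - y)) (\<phi> y))) \<le> ennreal c * (singular_kernel \<alpha> (x - y) * ennreal (A y))"
          by (simp add: mult.assoc)
      qed
      finally show ?thesis .
    qed
    define J where "J = (\<integral>\<^sup>+x. \<integral>\<^sup>+y. ennreal (A x) * singular_kernel \<alpha> (x - y) * ennreal (A y) \<partial>torus \<partial>torus)"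
    have "ennreal I \<le> (\<integral>\<^sup>+x. ennreal (norm (\<phi> x \<bullet> convolve C \<phi> x)) \<partial>torus)"
      unfolding I_def using norm_integral_le_nn_integral[of torus "\<lambda>x. \<phi> x \<bullet> convolve C \<phi> x"] by simp
    also have "\<dots> \<le> (\<integral>\<^sup>+x. ennreal c * (\<integral>\<^sup>+y. ennreal (A x) * singular_kernel \<alpha> (x - y) * ennreal (A y) \<partial>torus) \<partial>torus)"
    proof (rule nn_integral_mono)
      fix x :: "real^'n" assume x: "x \<in> space torus"
      have "ennreal (norm (\<phi> x \<bullet> convolve C \<phi> x)) \<le> ennreal (A x) * ennreal (norm (convolve C \<phi> x))"
        by (simp add: A_def ennreal_mult[symmetric] ennreal_leI Cauchy_Schwarz_ineq2)
      also have "\<dots> \<le> ennreal (A x) * (\<integral>\<^sup>+y. ennreal c * (singular_kernel \<alpha> (x - y) * ennreal (A y)) \<partial>torus)"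
        using x by (intro mult_left_mono conv_le) auto
      also have "\<dots> = ennreal c * (\<integral>\<^sup>+y. ennreal (A x) * singular_kernel \<alpha> (x - y) * ennreal (A y) \<partial>torus)"
        by (simp add: nn_integral_cmult mult.assoc mult.left_commute[of "ennreal (A x)" "ennreal c"])
      finally show "ennreal (norm (\<phi> x \<bullet> convolve C \<phi> x)) \<le> ennreal c * (\<integral>\<^sup>+y. ennreal (A x) * singular_kernel \<alpha> (x - y) * ennreal (A y) \<partial>torus)" .
    qed
    also have "\<dots> = ennreal c * J" unfolding J_def
      by (rule nn_integral_cmult) measurable
    finally have I_J: "ennreal I \<le> ennreal c * J" .
    \<comment> \<open>The inequality is not homogeneous in \<open>\<phi>\<close>, so it is applied to all multiples \<open>l \<phi>\<close> with \<open>l > 0\<close>.\<close>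
    have scaled: "ennreal (l\<^sup>2) * J \<le> ennreal ((l powr p * N)\<^sup>2 + 2 * (l powr p * N * D))" if l: "0 < l" for l
    proof -
      define a where "a x = l * A x" for x
      have [measurable]: "a \<in> borel_measurable borel" unfolding a_def[abs_def] by measurable
      have a: "0 \<le> a x" for x using l A_nonneg by (simp add: a_def)
      have int_a: "(\<integral>\<^sup>+x. ennreal (a x powr p) \<partial>torus) = ennreal (l powr p * N)"
        using l A_nonneg N \<open>0 \<le> N\<close> by (simp add: a_def powr_mult ennreal_mult nn_integral_cmult)
      have kernel_mass: "(\<integral>\<^sup>+y. singular_kernel \<beta> (x - y) \<partial>torus) \<le> ennreal D" "(\<integral>\<^sup>+y. singular_kernel \<beta> (y - x) \<partial>torus) \<le> ennreal D"
        if "x \<in> unit_cube" for x :: "real^'n"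
      proof -
        show "(\<integral>\<^sup>+y. singular_kernel \<beta> (x - y) \<partial>torus) \<le> ennreal D"
          using nn_integral_torus_singular_kernel_le[OF that, of \<beta>] D by simp
        moreover have "singular_kernel \<beta> (y - x) = singular_kernel \<beta> (x - y)" for y
        proof -
          have "\<bar>- t - 1\<bar> = \<bar>t + 1\<bar>" "\<bar>- t + 1\<bar> = \<bar>t - 1\<bar>" for t :: real by linarith+
          then have "near_int_dist (- t) = near_int_dist t" for t
            unfolding near_int_dist_def by (simp only: abs_minus_cancel min.commute)
          then have "coord_singularity \<beta> (- t) = coord_singularity \<beta> t" for t by (simp add: coord_singularity_def)
          from this[of "(y - x) \<bullet> b" for b] show ?thesis
            unfolding singular_kernel_def by (metis inner_minus_left minus_diff_eq)
        qed
        ultimately show "(\<integral>\<^sup>+y. singular_kernel \<beta> (y - x) \<partial>torus) \<le> ennreal D" by simp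
      qed
      have "ennreal (l\<^sup>2) * J = (\<integral>\<^sup>+x. \<integral>\<^sup>+y. ennreal (a x) * singular_kernel \<alpha> (x - y) * ennreal (a y) \<partial>torus \<partial>torus)"
        unfolding J_def using l A_nonneg
        by (simp add: nn_integral_cmult[symmetric] a_def ennreal_mult power2_eq_square mult_ac)
      also have "\<dots> \<le> (\<integral>\<^sup>+x. \<integral>\<^sup>+y. ennreal (a x powr p * a y powr p) + ennreal (a x powr p) * singular_kernel \<beta> (x - y)
          + ennreal (a y powr p) * singular_kernel \<beta> (x - y) \<partial>torus \<partial>torus)"
        unfolding \<beta>_def by (intro nn_integral_mono three_factor_bound q p a)
      also have "\<dots> = (\<integral>\<^sup>+x. \<integral>\<^sup>+y. ennreal (a x powr p * a y powr p) \<partial>torus \<partial>torus) +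
          (\<integral>\<^sup>+x. \<integral>\<^sup>+y. ennreal (a x powr p) * singular_kernel \<beta> (x - y) \<partial>torus \<partial>torus) +
          (\<integral>\<^sup>+x. \<integral>\<^sup>+y. ennreal (a y powr p) * singular_kernel \<beta> (x - y) \<partial>torus \<partial>torus)"
        by (simp add: nn_integral_add)
      also have "(\<integral>\<^sup>+x. \<integral>\<^sup>+y. ennreal (a y powr p) * singular_kernel \<beta> (x - y) \<partial>torus \<partial>torus) =
          (\<integral>\<^sup>+y. \<integral>\<^sup>+x. ennreal (a y powr p) * singular_kernel \<beta> (x - y) \<partial>torus \<partial>torus)"
        by (rule TT.Fubini'[symmetric]) measurable
      also have "(\<integral>\<^sup>+x. \<integral>\<^sup>+y. ennreal (a x powr p * a y powr p) \<partial>torus \<partial>torus) = ennreal ((l powr p * N)\<^sup>2)"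
        using l \<open>0 \<le> N\<close> by (simp add: ennreal_mult nn_integral_cmult nn_integral_multc int_a power2_eq_square)
      also have "(\<integral>\<^sup>+x. \<integral>\<^sup>+y. ennreal (a x powr p) * singular_kernel \<beta> (x - y) \<partial>torus \<partial>torus) \<le>
          (\<integral>\<^sup>+x. ennreal (a x powr p) * ennreal D \<partial>torus)"
        using kernel_mass(1) by (intro nn_integral_mono) (auto simp: nn_integral_cmult intro!: mult_left_mono)
      also have "(\<integral>\<^sup>+y. \<integral>\<^sup>+x. ennreal (a y powr p) * singular_kernel \<beta> (x - y) \<partial>torus \<partial>torus) \<le>
          (\<integral>\<^sup>+x. ennreal (a x powr p) * ennreal D \<partial>torus)"
        using kernel_mass(2) by (intro nn_integral_mono) (auto simp: nn_integral_cmult intro!: mult_left_mono)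
      also have "(\<integral>\<^sup>+x. ennreal (a x powr p) * ennreal D \<partial>torus) = ennreal (l powr p * N * D)"
        using D l \<open>0 \<le> N\<close> by (simp add: nn_integral_multc int_a ennreal_mult)
      finally show ?thesis
        using D l \<open>0 \<le> N\<close> by (simp add: ennreal_plus[symmetric] mult_ac add_ac del: ennreal_plus)
    qed
    have scaled_I: "l\<^sup>2 * I \<le> c * ((l powr p * N)\<^sup>2 + 2 * (l powr p * N * D))" if l: "0 < l" for l
    proof -
      have "ennreal (l\<^sup>2 * I) = ennreal (l\<^sup>2) * ennreal I" by (rule ennreal_mult) (auto simp: I_def)
      also have "\<dots> \<le> ennreal (l\<^sup>2) * (ennreal c * J)" by (intro mult_left_mono I_J) simp
      also have "\<dots> = ennreal c * (ennreal (l\<^sup>2) * J)" by (simp add: mult_ac)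
      also have "\<dots> \<le> ennreal c * ennreal ((l powr p * N)\<^sup>2 + 2 * (l powr p * N * D))"
        by (intro mult_left_mono scaled l) simp
      also have "\<dots> = ennreal (c * ((l powr p * N)\<^sup>2 + 2 * (l powr p * N * D)))"
        using c D \<open>0 \<le> N\<close> by (intro ennreal_mult[symmetric]) auto
      finally show ?thesis using c D \<open>0 \<le> N\<close> by (subst (asm) ennreal_le_iff) auto
    qed
    have Lp: "(Lp_norm p \<phi>)\<^sup>2 = N powr (2 / p)"
      by (simp add: Lp_norm_def N_def A_def power2_eq_square powr_add[symmetric])
    show "\<bar>LINT x|torus. \<phi> x \<bullet> convolve C \<phi> x\<bar> \<le> c * (1 + 2 * D) * (Lp_norm p \<phi>)\<^sup>2"
    \<comment> \<open>If \<open>N = 0\<close> the scaled inequality gives \<open>I \<le> 0\<close>; otherwise \<open>l\<close> normalises \<open>\<phi>\<close> in \<open>L\<^sup>p\<close>.\<close>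
    proof (cases "N = 0")
      case True
      then show ?thesis using scaled_I[of 1] Lp p0 by (simp add: I_def)
    next
      case False
      then have "0 < N" using \<open>0 \<le> N\<close> by simp
      define l where "l = N powr (- (1 / p))"
      have l: "0 < l" using \<open>0 < N\<close> by (simp add: l_def)
      have "l powr p = N powr - 1" using p0 by (simp add: l_def powr_powr)
      then have "l powr p * N = 1" using \<open>0 < N\<close> by (simp add: powr_minus)
      then have "l\<^sup>2 * I \<le> c * (1 + 2 * D)" using scaled_I[OF l] by simp
      moreover have l2: "l\<^sup>2 * N powr (2 / p) = 1"
        using \<open>0 < N\<close> by (simp add: l_def power2_eq_square powr_add[symmetric])
      ultimately have I_le: "(l\<^sup>2 * I) * N powr (2 / p) \<le> c * (1 + 2 * D) * N powr (2 / p)"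
        by (intro mult_right_mono) auto
      have "(l\<^sup>2 * I) * N powr (2 / p) = (l\<^sup>2 * N powr (2 / p)) * I" by (simp only: mult_ac)
      also have "\<dots> = I" by (simp only: l2 mult_1)
      finally show ?thesis using I_le unfolding I_def Lp by (simp only:)
    qed
  qed
qed

section \<open>Test functions and distributions\<close>

lemma smooth_has_partial:
  assumes "smooth f"
  shows "((\<lambda>t. partials is f (x + t *\<^sub>R axis i 1)) has_vector_derivative partials (i # is) f x) (at 0)"
  using assms by (auto simp: smooth_def partials_def partial_def vector_derivative_works[symmetric])

lemma partialsI:
  assumes "\<And>x. ((\<lambda>t. partials is f (x + t *\<^sub>R axis i 1)) has_vector_derivative g x) (at 0)"
  shows "partials (i # is) f = g"
  using assms by (auto simp: partials_def partial_def fun_eq_iff intro!: vector_derivative_at)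

lemma partials_lincomb:
  assumes "smooth f" "smooth g"
  shows "partials is (\<lambda>x. a *\<^sub>R f x + b *\<^sub>R g x) = (\<lambda>x. a *\<^sub>R partials is f x + b *\<^sub>R partials is g x)"
proof (induction "is")
  case Nil
  then show ?case by (simp add: partials_def)
next
  case (Cons i "is")
  show ?case
    by (rule partialsI, unfold Cons.IH)
       (intro has_vector_derivative_add bounded_linear.has_vector_derivative[OF bounded_linear_scaleR_right]
         smooth_has_partial assms)
qed

lemma smooth_lincomb:
  assumes "smooth f" "smooth g"
  shows "smooth (\<lambda>x. a *\<^sub>R f x + b *\<^sub>R g x)"
  unfolding smooth_def partials_lincomb[OF assms]
  using assms unfolding smooth_def by (auto intro!: continuous_intros derivative_intros)

lemma scaled_reflect_has_partial:
  assumes "smooth f"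
  shows "((\<lambda>t. c *\<^sub>R partials is f (- (x + t *\<^sub>R axis i 1))) has_vector_derivative
    (- c) *\<^sub>R partials (i # is) f (- x)) (at 0)"
proof -
  have "((\<lambda>t. partials is f (- x + t *\<^sub>R axis i 1)) \<circ> uminus has_vector_derivative (-1) *\<^sub>R partials (i # is) f (- x)) (at 0)"
    by (rule vector_diff_chain_at)
      (use smooth_has_partial[OF assms, of "is" "- x" i] in \<open>auto intro!: derivative_eq_intros simp: has_vector_derivative_def\<close>)
  moreover have "- x + (- t) *\<^sub>R axis i 1 = - (x + t *\<^sub>R axis i 1)" for t by simp
  ultimately have "((\<lambda>t. partials is f (- (x + t *\<^sub>R axis i 1))) has_vector_derivative (-1) *\<^sub>R partials (i # is) f (- x)) (at 0)"
    by (simp only: o_def)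
  from bounded_linear.has_vector_derivative[OF bounded_linear_scaleR_right this, of c]
  show ?thesis by simp
qed

lemma partials_reflect:
  assumes "smooth f"
  shows "partials is (\<lambda>x. f (- x)) = (\<lambda>x. (-1) ^ length is *\<^sub>R partials is f (- x))"
proof (induction "is")
  case Nil
  then show ?case by (simp add: partials_def)
next
  case (Cons i "is")
  show ?case
    by (rule partialsI, unfold Cons.IH length_Cons power_Suc mult_minus1)
       (rule scaled_reflect_has_partial[OF assms])
qed

lemma smooth_reflect:
  fixes f :: "real^'n \<Rightarrow> 'e::real_normed_vector"
  assumes f: "smooth f"
  shows "smooth (\<lambda>x. f (- x))"
  unfolding smooth_def
proof (intro allI conjI)
  fix "is" :: "'n list" and i x
  have "continuous_on UNIV (partials is f)" using f by (simp add: smooth_def)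
  from continuous_on_compose2[OF this continuous_on_minus[OF continuous_on_id], of UNIV]
  have "continuous_on UNIV (\<lambda>x. partials is f (- x))" by simp
  then show "continuous_on UNIV (partials is (\<lambda>x. f (- x)))"
    unfolding partials_reflect[OF f] by (rule continuous_on_scaleR[OF continuous_on_const])
  show "(\<lambda>t. partials is (\<lambda>x. f (- x)) (x + t *\<^sub>R axis i 1)) differentiable (at 0)"
    unfolding partials_reflect[OF f] using scaled_reflect_has_partial[OF f]
    by (rule differentiableI_vector)
qed

lemma test_funs_lincomb:
  assumes "\<phi> \<in> test_funs" "\<psi> \<in> test_funs"
  shows "(\<lambda>x. a *\<^sub>R \<phi> x + b *\<^sub>R \<psi> x) \<in> test_funs"
  using assms by (auto simp: test_funs_def periodic_def intro: smooth_lincomb)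

lemma zero_test_fun: "(\<lambda>x :: real^'n. 0 :: 'e::euclidean_space) \<in> test_funs"
proof -
  have zero: "partials is (\<lambda>x :: real^'n. 0 :: 'e) = (\<lambda>x. 0)" for "is"
    by (induction "is") (auto simp: partials_def partial_def fun_eq_iff)
  have "smooth (\<lambda>x :: real^'n. 0 :: 'e)"
    unfolding smooth_def
  proof (intro allI conjI)
    show "continuous_on UNIV (partials is (\<lambda>x :: real^'n. 0 :: 'e))" for "is"
      by (subst zero) (rule continuous_on_const)
    show "(\<lambda>t. partials is (\<lambda>x :: real^'n. 0 :: 'e) (x + t *\<^sub>R axis i 1)) differentiable at 0" for "is" i x
      by (subst zero) (rule differentiable_const)
  qed
  then show ?thesis unfolding test_funs_def periodic_def by simp
qed

lemma test_funs_scale: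
  assumes "\<phi> \<in> test_funs" shows "(\<lambda>x. a *\<^sub>R \<phi> x) \<in> test_funs"
  using test_funs_lincomb[OF assms assms, of a 0] by simp

lemma test_funs_sum:
  assumes "\<And>k. k \<in> K \<Longrightarrow> \<phi> k \<in> test_funs"
  shows "(\<lambda>x. \<Sum>k\<in>K. t k *\<^sub>R \<phi> k x) \<in> test_funs"
  using assms
proof (induction K rule: infinite_finite_induct)
  case (insert k K)
  then show ?case
    using test_funs_lincomb[of "\<phi> k" "\<lambda>x. \<Sum>k\<in>K. t k *\<^sub>R \<phi> k x" "t k" 1] by simp
qed (simp_all add: zero_test_fun)

lemma test_funs_reflect: "\<phi> \<in> test_funs \<Longrightarrow> (\<lambda>x. \<phi> (- x)) \<in> test_funs"
proof -
  assume \<phi>: "\<phi> \<in> test_funs"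
  have "\<phi> (- (x + z)) = \<phi> (- x)" if "z \<in> int_lattice" for x z
  proof -
    have "- z \<in> int_lattice" using that by (simp add: int_lattice_def)
    then have "\<phi> (- x + - z) = \<phi> (- x)" using \<phi> unfolding test_funs_def periodic_def by blast
    then show ?thesis by simp
  qed
  then show ?thesis using \<phi> by (auto simp: test_funs_def periodic_def intro: smooth_reflect)
qed

lemma test_fun_continuous:
  assumes "\<phi> \<in> test_funs" shows "continuous_on UNIV \<phi>"
proof -
  have "continuous_on UNIV (partials [] \<phi>)" using assms by (simp only: test_funs_def smooth_def mem_Collect_eq)
  then show ?thesis by (simp add: partials_def)
qed

lemma CN_norm_reflect:
  assumes "\<phi> \<in> test_funs"
  shows "CN_norm N (\<lambda>x. \<phi> (- x)) = CN_norm N \<phi>"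
proof -
  have s: "smooth \<phi>" using assms by (simp add: test_funs_def)
  let ?S = "{is :: 'a list. length is \<le> N} \<times> (UNIV :: (real^'a) set)"
  have "(\<lambda>(is, x). norm (partials is (\<lambda>x. \<phi> (- x)) x)) ` ?S = (\<lambda>(is, x). norm (partials is \<phi> x)) ` (\<lambda>(is, x). (is, - x)) ` ?S"
    unfolding image_image partials_reflect[OF s] by (intro image_cong refl) (auto simp: power_abs[symmetric])
  also have "(\<lambda>(is, x). (is, - x)) ` ?S = ?S"
    by (auto simp: image_iff) (metis minus_minus)
  finally show ?thesis by (simp add: CN_norm_def)
qed

lemma distribution_lincomb:
  assumes T: "T \<in> distributions" and "\<phi> \<in> test_funs" "\<psi> \<in> test_funs"
  shows "T (\<lambda>x. a *\<^sub>R \<phi> x + b *\<^sub>R \<psi> x) = a * T \<phi> + b * T \<psi>"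
proof -
  have add: "T (\<lambda>x. f x + g x) = T f + T g" if "f \<in> test_funs" "g \<in> test_funs" for f g
    using T that unfolding distributions_def by blast
  have "T (\<lambda>x. a *\<^sub>R \<phi> x + b *\<^sub>R \<psi> x) = T (\<lambda>x. a *\<^sub>R \<phi> x) + T (\<lambda>x. b *\<^sub>R \<psi> x)"
    by (intro add test_funs_scale assms)
  also have "\<dots> = a * T \<phi> + b * T \<psi>" using T assms(2,3) unfolding distributions_def by auto
  finally show ?thesis by simp
qed

lemma distribution_zero:
  assumes T: "T \<in> distributions" shows "T (\<lambda>x. 0) = 0"
  using distribution_lincomb[OF T zero_test_fun zero_test_fun, of 0 0] by simp

lemma distribution_sum:
  assumes T: "T \<in> distributions" and "\<And>k. k \<in> K \<Longrightarrow> \<phi> k \<in> test_funs"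
  shows "T (\<lambda>x. \<Sum>k\<in>K. t k *\<^sub>R \<phi> k x) = (\<Sum>k\<in>K. t k * T (\<phi> k))"
  using assms(2)
proof (induction K rule: infinite_finite_induct)
  case (insert k K)
  then show ?case
    using distribution_lincomb[OF T, of "\<phi> k" "\<lambda>x. \<Sum>k\<in>K. t k *\<^sub>R \<phi> k x" "t k" 1] test_funs_sum[of K \<phi> t] by simp
qed (simp_all add: distribution_zero[OF T])

lemma reflect_distribution:
  assumes T: "T \<in> distributions" shows "reflect T \<in> distributions"
proof -
  obtain N B where B: "\<And>\<phi>. \<phi> \<in> test_funs \<Longrightarrow> \<bar>T \<phi>\<bar> \<le> B * CN_norm N \<phi>"
    using T unfolding distributions_def by blast
  have "\<bar>reflect T \<phi>\<bar> \<le> B * CN_norm N \<phi>" if "\<phi> \<in> test_funs" for \<phi>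
    using B[OF test_funs_reflect[OF that]] that CN_norm_reflect[OF that] by (simp add: reflect_def)
  moreover have "reflect T (\<lambda>x. \<phi> x + \<psi> x) = reflect T \<phi> + reflect T \<psi>" if "\<phi> \<in> test_funs" "\<psi> \<in> test_funs" for \<phi> \<psi>
    using distribution_lincomb[OF T test_funs_reflect[OF that(1)] test_funs_reflect[OF that(2)], of 1 1] that
      test_funs_lincomb[OF that, of 1 1] by (simp add: reflect_def)
  moreover have "reflect T (\<lambda>x. c *\<^sub>R \<phi> x) = c * reflect T \<phi>" if "\<phi> \<in> test_funs" for \<phi> c
    using distribution_lincomb[OF T test_funs_reflect[OF that] test_funs_reflect[OF that], of c 0] that
      test_funs_scale[OF that] by (simp add: reflect_def)
  moreover have "reflect T \<in> extensional test_funs" by (simp add: reflect_def)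
  ultimately show ?thesis unfolding distributions_def by blast
qed

lemma negate_distribution:
  assumes T: "T \<in> distributions" shows "negate T \<in> distributions"
proof -
  obtain N B where B: "\<And>\<phi>. \<phi> \<in> test_funs \<Longrightarrow> \<bar>T \<phi>\<bar> \<le> B * CN_norm N \<phi>"
    using T unfolding distributions_def by blast
  have "\<bar>negate T \<phi>\<bar> \<le> B * CN_norm N \<phi>" if "\<phi> \<in> test_funs" for \<phi>
    using B[OF that] that by (simp add: negate_def)
  moreover have "negate T (\<lambda>x. \<phi> x + \<psi> x) = negate T \<phi> + negate T \<psi>" if "\<phi> \<in> test_funs" "\<psi> \<in> test_funs" for \<phi> \<psi>
    using distribution_lincomb[OF T that, of 1 1] that test_funs_lincomb[OF that, of 1 1] by (simp add: negate_def)
  moreover have "negate T (\<lambda>x. c *\<^sub>R \<phi> x) = c * negate T \<phi>" if "\<phi> \<in> test_funs" for \<phi> c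
    using distribution_lincomb[OF T that that, of c 0] that test_funs_scale[OF that] by (simp add: negate_def)
  moreover have "negate T \<in> extensional test_funs" by (simp add: negate_def)
  ultimately show ?thesis unfolding distributions_def by blast
qed

lemma measurable_distr_spaceI:
  assumes "\<And>\<phi>. \<phi> \<in> test_funs \<Longrightarrow> (\<lambda>\<omega>. X \<omega> \<phi>) \<in> borel_measurable M" and "\<And>\<omega>. \<omega> \<in> space M \<Longrightarrow> X \<omega> \<in> distributions"
  shows "X \<in> M \<rightarrow>\<^sub>M distr_space"
  unfolding distr_space_def
proof (rule measurable_restrict_space2)
  show "X \<in> space M \<rightarrow> distributions" using assms by auto
  have "(\<lambda>\<omega>. \<lambda>\<phi>\<in>test_funs. X \<omega> \<phi>) \<in> M \<rightarrow>\<^sub>M (\<Pi>\<^sub>M \<phi>\<in>test_funs. borel)"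
    by (intro measurable_restrict assms)
  moreover have "(\<lambda>\<phi>\<in>test_funs. X \<omega> \<phi>) = X \<omega>" if "\<omega> \<in> space M" for \<omega>
    using assms(2)[OF that] by (auto simp: distributions_def intro: extensional_restrict)
  ultimately show "X \<in> M \<rightarrow>\<^sub>M (\<Pi>\<^sub>M \<phi>\<in>test_funs. borel)"
    by (simp cong: measurable_cong)
qed

lemma
  assumes "X \<in> M \<rightarrow>\<^sub>M distr_space"
  shows measurable_eval: "\<phi> \<in> test_funs \<Longrightarrow> (\<lambda>\<omega>. X \<omega> \<phi>) \<in> borel_measurable M"
    and value_distribution: "\<omega> \<in> space M \<Longrightarrow> X \<omega> \<in> distributions"
proof -
  have X: "X \<in> M \<rightarrow>\<^sub>M (\<Pi>\<^sub>M \<phi>\<in>test_funs. borel)" "X \<in> space M \<rightarrow> distributions"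
    using assms unfolding distr_space_def by (auto simp: measurable_restrict_space2_iff)
  show "\<phi> \<in> test_funs \<Longrightarrow> (\<lambda>\<omega>. X \<omega> \<phi>) \<in> borel_measurable M"
    using measurable_compose[OF X(1) measurable_component_singleton[of \<phi> test_funs "\<lambda>_. borel"]] by simp
  show "\<omega> \<in> space M \<Longrightarrow> X \<omega> \<in> distributions" using X(2) by auto
qed

text \<open>
  Linear combinations of evaluations of a distribution are again evaluations, so the Cramer--Wold
  theorem only needs the evaluations one at a time.
\<close>

lemma law_eq_if_cos_eq:
  fixes Y Z :: "'w \<Rightarrow> ('n::finite, 'e::euclidean_space) functional"
  assumes M: "prob_space M" and Y: "Y \<in> M \<rightarrow>\<^sub>M distr_space" and Z: "Z \<in> M \<rightarrow>\<^sub>M distr_space"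
    and eq: "\<And>\<psi> c. \<psi> \<in> test_funs \<Longrightarrow> (LINT \<omega>|M. cos (Y \<omega> \<psi> + c)) = (LINT \<omega>|M. cos (Z \<omega> \<psi> + c))"
  shows "law M Y = law M Z"
proof -
  let ?P = "(\<Pi>\<^sub>M \<phi>\<in>(test_funs :: (real^'n \<Rightarrow> 'e) set). borel) :: ((real^'n \<Rightarrow> 'e) \<Rightarrow> real) measure"
  have sums: "(\<Sum>k\<in>K. t k * W \<omega> k) = W \<omega> (\<lambda>x. \<Sum>k\<in>K. t k *\<^sub>R k x)"
    if "W \<in> M \<rightarrow>\<^sub>M distr_space" "K \<subseteq> test_funs" "\<omega> \<in> space M" for W :: "'w \<Rightarrow> (real^'n \<Rightarrow> 'e) \<Rightarrow> real" and K t \<omega>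
    by (rule distribution_sum[OF value_distribution[OF that(1,3)], symmetric]) (use that(2) in blast)
  have restr: "distr M ?P (\<lambda>\<omega>. \<lambda>\<phi>\<in>test_funs. W \<omega> \<phi>) = distr M ?P W" "W \<in> M \<rightarrow>\<^sub>M ?P"
    if W: "W \<in> M \<rightarrow>\<^sub>M distr_space" for W :: "'w \<Rightarrow> (real^'n \<Rightarrow> 'e) \<Rightarrow> real"
  proof -
    show "W \<in> M \<rightarrow>\<^sub>M ?P" using W unfolding distr_space_def by (auto simp: measurable_restrict_space2_iff)
    show "distr M ?P (\<lambda>\<omega>. \<lambda>\<phi>\<in>test_funs. W \<omega> \<phi>) = distr M ?P W"
      using value_distribution[OF W] by (intro distr_cong refl) (auto simp: distributions_def intro: extensional_restrict)
  qed
  have "distr M ?P (\<lambda>\<omega>. \<lambda>\<phi>\<in>test_funs. Y \<omega> \<phi>) = distr M ?P (\<lambda>\<omega>. \<lambda>\<phi>\<in>test_funs. Z \<omega> \<phi>)"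
  proof (rule distr_PiM_eq_if_cos_eq[OF M M])
    fix K :: "(real^'n \<Rightarrow> 'e) set" and t c assume K: "finite K" "K \<subseteq> test_funs"
    have "(\<lambda>x. \<Sum>k\<in>K. t k *\<^sub>R k x) \<in> test_funs" using K(2) by (intro test_funs_sum) auto
    from eq[OF this, of c]
    show "(LINT \<omega>|M. cos ((\<Sum>i\<in>K. t i * Y \<omega> i) + c)) = (LINT \<omega>|M. cos ((\<Sum>i\<in>K. t i * Z \<omega> i) + c))"
      by (simp add: sums[OF Y K(2)] sums[OF Z K(2)] cong: Bochner_Integration.integral_cong)
  qed (use measurable_eval Y Z in auto)
  then have eqP: "distr M ?P Y = distr M ?P Z" using restr Y Z by simp
  show ?thesis unfolding law_def
  proof (rule measure_eqI)
    fix B :: "((real^'n \<Rightarrow> 'e) \<Rightarrow> real) set" assume "B \<in> sets (distr M distr_space Y)"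
    then obtain A where A: "A \<in> sets ?P" "B = distributions \<inter> A" and B: "B \<in> sets distr_space"
      by (auto simp: distr_space_def sets_restrict_space)
    have "emeasure (distr M distr_space W) B = emeasure (distr M ?P W) A" if W: "W \<in> M \<rightarrow>\<^sub>M distr_space" for W
    proof -
      have "W -` B \<inter> space M = W -` A \<inter> space M" using value_distribution[OF W] A by auto
      then show ?thesis using W restr(2)[OF W] A B by (simp add: emeasure_distr)
    qed
    then show "emeasure (distr M distr_space Y) B = emeasure (distr M distr_space Z) B" using Y Z eqP by simp
  qed simp
qed

section \<open>Reflections of the torus\<close>

text \<open>
  The map \<open>x \<mapsto> - x\<close> on representatives in the unit cube.
\<close>

definition torus_minus :: "real^'n \<Rightarrow> real^'n" where
  "torus_minus x = (\<chi> i. if x $ i = 0 then 0 else 1 - x $ i)"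

lemma measurable_torus_minus_borel: "(torus_minus :: real^'n \<Rightarrow> _) \<in> borel \<rightarrow>\<^sub>M borel"
proof (rule borel_measurable_euclidean_space[THEN iffD2], rule ballI)
  fix b :: "real^'n" assume "b \<in> Basis"
  then obtain i where b: "b = axis i 1" by (auto simp: Basis_vec_def)
  have "(\<lambda>x :: real^'n. if x $ i = 0 then 0 else 1 - x $ i) \<in> borel_measurable borel" by measurable
  then show "(\<lambda>x. torus_minus x \<bullet> b) \<in> borel_measurable borel" by (simp add: b inner_axis torus_minus_def)
qed

lemma torus_minus_in: "x \<in> unit_cube \<Longrightarrow> torus_minus x \<in> unit_cube"
  by (auto simp: torus_minus_def less_le)

lemma torus_minus_involution: "x \<in> unit_cube \<Longrightarrow> torus_minus (torus_minus x) = x"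
  by (auto simp: torus_minus_def vec_eq_iff less_le)

lemma measurable_torus_minus: "torus_minus \<in> torus \<rightarrow>\<^sub>M torus"
  unfolding torus_def
proof (rule measurable_restrict_space3)
  show "torus_minus \<in> lborel \<rightarrow>\<^sub>M lborel" using measurable_torus_minus_borel by simp
  show "torus_minus \<in> unit_cube \<rightarrow> unit_cube" by (rule funcsetI) (rule torus_minus_in)
qed

lemma periodic_minus:
  assumes "periodic f" "x \<in> unit_cube"
  shows "f (- x) = f (torus_minus x)"
proof -
  have "torus_minus x - (- x) \<in> int_lattice"
    by (auto simp: int_lattice_def torus_minus_def)
  then have "f (- x + (torus_minus x - (- x))) = f (- x)" using assms unfolding periodic_def by blast
  then show ?thesis by simp
qed

lemma AE_component_neq: "AE x in (lborel :: (real^'n) measure). x $ i \<noteq> c"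
proof -
  have "negligible {x :: real^'n. x \<bullet> axis i 1 = c}"
    by (rule negligible_standard_hyperplane) simp
  then have "{x :: real^'n. x $ i = c} \<in> null_sets lebesgue"
    by (simp add: negligible_iff_null_sets inner_axis)
  then have "{x :: real^'n. x $ i = c} \<in> null_sets lborel"
    by (subst (asm) null_sets_completion_iff) auto
  then show ?thesis by (rule AE_I') auto
qed

text \<open>
  Off the null set where a coordinate is an integer, \<open>torus_minus\<close> is the affine map \<open>x \<mapsto> (1, \<dots>, 1) - x\<close>,
  which preserves Lebesgue measure and the unit cube.
\<close>

lemma distr_torus_minus: "distr torus torus torus_minus = (torus :: (real^'n) measure)"
proof (rule measure_eqI)
  fix A :: "(real^'n) set" assume "A \<in> sets (distr torus torus torus_minus)"
  then have A: "A \<in> sets torus" by simp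
  then have A': "A \<in> sets borel" "A \<subseteq> unit_cube"
    using sets_restrict_space_iff[of unit_cube lborel A] unit_cube_borel by (auto simp: torus_def)
  note [measurable] = A'(1) unit_cube_borel measurable_torus_minus_borel
  let ?o = "(\<chi> i. 1) :: real^'n"
  have "emeasure (distr torus torus torus_minus) A = (\<integral>\<^sup>+x. indicator A x \<partial>distr torus torus torus_minus)"
    using A by simp
  also have "\<dots> = (\<integral>\<^sup>+x. indicator A (torus_minus x) \<partial>torus)"
    by (rule nn_integral_distr[OF measurable_torus_minus]) (use A in simp)
  also have "\<dots> = (\<integral>\<^sup>+x. indicator A (torus_minus x) * indicator unit_cube x \<partial>lborel)"
    by (rule nn_integral_torus)
  also have "\<dots> = (\<integral>\<^sup>+x. indicator A (?o - x) \<partial>lborel)"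
  proof (rule nn_integral_cong_AE)
    have "AE x in (lborel :: (real^'n) measure). \<forall>i. x $ i \<noteq> 0 \<and> x $ i \<noteq> 1"
      by (simp add: AE_all_countable AE_component_neq)
    then show "AE x in lborel. indicator A (torus_minus x) * indicator unit_cube x = (indicator A (?o - x) :: ennreal)"
    proof eventually_elim
      case (elim x)
      have tm: "torus_minus x = ?o - x" using elim by (simp add: torus_minus_def vec_eq_iff)
      show ?case
      proof (cases "x \<in> unit_cube")
        case True then show ?thesis by (simp add: tm)
      next
        case False
        then have "?o - x \<notin> unit_cube" using elim by (auto simp: less_le)
        then show ?thesis using A'(2) False by (auto simp: indicator_def)
      qed
    qed
  qed
  also have "\<dots> = (\<integral>\<^sup>+x. indicator A x \<partial>distr lborel borel (\<lambda>x. ?o - x))"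
    by (subst nn_integral_distr) auto
  also have "distr lborel borel (\<lambda>x. ?o - x) = lborel"
    using lborel_affine[of "-1" ?o] by (simp add: density_1)
  also have "(\<integral>\<^sup>+x. indicator A x \<partial>lborel) = emeasure lborel A" by simp
  also have "\<dots> = emeasure torus A"
    unfolding torus_def using A' unit_cube_borel by (subst emeasure_restrict_space) auto
  finally show "emeasure (distr torus torus torus_minus) A = emeasure torus A" .
qed simp

text \<open>
  Since \<open>torus_minus\<close> is an involution, \<open>f\<close> and its reflection are measurable together; otherwise
  both integrals are \<open>0\<close> by convention.  This generality spares a proof that the convolution
  \<open>C * \<phi>\<close> is measurable.
\<close>

lemma integral_torus_reflect:
  fixes f :: "real^'n \<Rightarrow> 'b::{banach, second_countable_topology}"
  assumes "periodic f"
  shows "(LINT x|torus. f (- x)) = (LINT x|torus. f x)"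
proof -
  have "(LINT x|torus. f (- x)) = (LINT x|torus. f (torus_minus x))"
    by (intro Bochner_Integration.integral_cong refl periodic_minus[OF assms]) simp
  also have "\<dots> = (LINT x|torus. f x)"
  proof (cases "f \<in> borel_measurable torus")
    case True
    then have "(LINT x|torus. f (torus_minus x)) = (LINT x|distr torus torus torus_minus. f x)"
      by (subst integral_distr[OF measurable_torus_minus]) auto
    then show ?thesis by (simp add: distr_torus_minus)
  next
    case False
    have "(\<lambda>x. f (torus_minus x)) \<notin> borel_measurable torus"
    proof
      assume "(\<lambda>x. f (torus_minus x)) \<in> borel_measurable torus"
      from measurable_compose[OF measurable_torus_minus this]
      have "(\<lambda>x. f (torus_minus (torus_minus x))) \<in> borel_measurable torus" .
      then have "f \<in> borel_measurable torus"
        by (subst measurable_cong[where g = "\<lambda>x. f (torus_minus (torus_minus x))"])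
           (simp_all add: torus_minus_involution[unfolded mem_Collect_eq])
      with False show False ..
    qed
    then have ni: "\<not> integrable torus (\<lambda>x. f (torus_minus x))" "\<not> integrable torus f"
      using False borel_measurable_integrable by blast+
    show ?thesis by (simp add: not_integrable_integral_eq[OF ni(1)] not_integrable_integral_eq[OF ni(2)])
  qed
  finally show ?thesis .
qed

lemma convolve_reflect:
  fixes C :: "real^'n \<Rightarrow> 'e::euclidean_space \<Rightarrow>\<^sub>L 'e"
  assumes C: "periodic C" "\<And>x. C x = C (- x)" and \<phi>: "periodic \<phi>"
  shows "convolve C (\<lambda>x. \<phi> (- x)) x = convolve C \<phi> (- x)"
proof -
  have "periodic (\<lambda>y. blinfun_apply (C (x + y)) (\<phi> y))"
    unfolding periodic_def
  proof (intro allI ballI)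
    fix y z :: "real^'n" assume "z \<in> int_lattice"
    then have "C ((x + y) + z) = C (x + y)" "\<phi> (y + z) = \<phi> y" using C \<phi> unfolding periodic_def by blast+
    then show "blinfun_apply (C (x + (y + z))) (\<phi> (y + z)) = blinfun_apply (C (x + y)) (\<phi> y)" by (simp add: add.assoc)
  qed
  from integral_torus_reflect[OF this]
  have "(LINT y|torus. blinfun_apply (C (x - y)) (\<phi> (- y))) = (LINT y|torus. blinfun_apply (C (x + y)) (\<phi> y))" by simp
  also have "\<dots> = (LINT y|torus. blinfun_apply (C (- x - y)) (\<phi> y))"
    using C(2)[of "x + y" for y] by simp
  finally show ?thesis by (simp add: convolve_def)
qed

lemma quadratic_form_reflect:
  fixes C :: "real^'n \<Rightarrow> 'e::euclidean_space \<Rightarrow>\<^sub>L 'e"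
  assumes C: "periodic C" "\<And>x. C x = C (- x)" and \<phi>: "periodic \<phi>"
  shows "(LINT x|torus. \<phi> (- x) \<bullet> convolve C (\<lambda>x. \<phi> (- x)) x) = (LINT x|torus. \<phi> x \<bullet> convolve C \<phi> x)"
proof -
  have "periodic (\<lambda>x. \<phi> x \<bullet> convolve C \<phi> x)"
    unfolding periodic_def
  proof (intro allI ballI)
    fix x z :: "real^'n" assume z: "z \<in> int_lattice"
    have "C ((x - y) + z) = C (x - y)" "\<phi> (x + z) = \<phi> x" for y using C \<phi> z unfolding periodic_def by blast+
    then show "\<phi> (x + z) \<bullet> convolve C \<phi> (x + z) = \<phi> x \<bullet> convolve C \<phi> x"
      by (simp add: convolve_def add_diff_eq diff_add_eq)
  qed
  from integral_torus_reflect[OF this] show ?thesis by (simp add: convolve_reflect[OF C \<phi>])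
qed

section \<open>Centred Gaussian random fields\<close>

text \<open>
  A centred point mass sits at \<open>0\<close>; a centred normal density is a rescaling of the standard one, whose
  characteristic function is \<open>exp (- t\<^sup>2 / 2)\<close>.
\<close>

lemma (in prob_space) centred_gaussian_measure:
  assumes Y [measurable]: "Y \<in> borel_measurable M" and gauss: "gaussian_measure (distr M borel Y)"
    and mean: "expectation Y = 0"
  shows centred_gaussian_square_integrable: "integrable M (\<lambda>\<omega>. (Y \<omega>)\<^sup>2)"
    and centred_gaussian_expectation_cos:
      "expectation (\<lambda>\<omega>. cos (Y \<omega> + c)) = exp (- expectation (\<lambda>\<omega>. (Y \<omega>)\<^sup>2) / 2) * cos c"
proof -
  have "integrable M (\<lambda>\<omega>. (Y \<omega>)\<^sup>2) \<and>
    expectation (\<lambda>\<omega>. cos (Y \<omega> + c)) = exp (- expectation (\<lambda>\<omega>. (Y \<omega>)\<^sup>2) / 2) * cos c"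
    using gauss unfolding gaussian_measure_def
  proof (elim disjE exE conjE)
    fix m assume d: "distr M borel Y = return borel m"
    have E: "expectation (\<lambda>\<omega>. g (Y \<omega>)) = g m" if [measurable]: "g \<in> borel_measurable borel" for g :: "real \<Rightarrow> real"
      using integral_distr[of Y M borel g] unfolding d by (simp add: integral_return)
    have m: "m = 0" using E[of "\<lambda>x. x"] mean by simp
    have "integrable (return borel m) (\<lambda>x. x\<^sup>2)"
      by (intro integrableI_bounded) (auto simp: nn_integral_return)
    then have "integrable M (\<lambda>\<omega>. (Y \<omega>)\<^sup>2)"
      unfolding d[symmetric] by (subst (asm) integrable_distr_eq) auto
    then show ?thesis using E[of "\<lambda>x. x\<^sup>2"] E[of "\<lambda>x. cos (x + c)"] m by simp
  next
    fix m s :: real assume s: "0 < s" and d: "distr M borel Y = density lborel (\<lambda>x. ennreal (normal_density m s x))"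
    have D: "distributed M lborel Y (normal_density m s)"
      unfolding distributed_def using d by (simp cong: distr_cong)
    have m: "m = 0" using normal_distributed_expectation[OF s D] mean by simp
    have V: "expectation (\<lambda>\<omega>. (Y \<omega>)\<^sup>2) = s\<^sup>2"
      using normal_distributed_variance[OF s D] mean by simp
    have "integrable lborel (\<lambda>x. normal_density m s x * x\<^sup>2)"
      using integrable_normal_moment[OF s, of m 2] m by simp
    then have int: "integrable M (\<lambda>\<omega>. (Y \<omega>)\<^sup>2)"
      using distributed_integrable[OF D, of "\<lambda>x. x\<^sup>2"] by simp
    define Z where "Z \<omega> = Y \<omega> / s" for \<omega>
    have DZ: "distributed M lborel Z std_normal_density"
      using D normal_standard_normal_convert[OF s, of Y m] m by (simp add: Z_def[abs_def])
    have [measurable]: "Z \<in> borel_measurable M" unfolding Z_def[abs_def] by measurable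
    have "distr M borel Z = std_normal_distribution"
      using DZ unfolding distributed_def by (simp cong: distr_cong)
    then have "char (distr M borel Z) s = complex_of_real (exp (- (s\<^sup>2) / 2))"
      by (simp add: char_std_normal_distribution)
    then have ch: "(CLINT \<omega>|M. iexp (s * Z \<omega>)) = complex_of_real (exp (- (s\<^sup>2) / 2))"
      unfolding char_def by (subst (asm) integral_distr) auto
    have ii: "integrable M (\<lambda>\<omega>. iexp (s * Z \<omega>))"
      using integrable_iexp[of "\<lambda>\<omega>. complex_of_real (s * Z \<omega>)"] by simp
    have sZ: "s * Z \<omega> = Y \<omega>" for \<omega> using s by (simp add: Z_def)
    have "expectation (\<lambda>\<omega>. cos (Y \<omega>)) = exp (- (s\<^sup>2) / 2)"
      using arg_cong[OF ch, of Re] integral_Re[OF ii] by (simp add: Re_exp sZ del: of_real_mult)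
    moreover have "expectation (\<lambda>\<omega>. sin (Y \<omega>)) = 0"
      using arg_cong[OF ch, of Im] integral_Im[OF ii] by (simp add: Im_exp sZ del: of_real_mult)
    moreover have "integrable M (\<lambda>\<omega>. cos (Y \<omega>))" "integrable M (\<lambda>\<omega>. sin (Y \<omega>))"
      by (auto intro!: integrable_const_bound[where B = 1])
    ultimately show ?thesis using int V by (simp add: cos_add)
  qed
  then show "integrable M (\<lambda>\<omega>. (Y \<omega>)\<^sup>2)"
    "expectation (\<lambda>\<omega>. cos (Y \<omega> + c)) = exp (- expectation (\<lambda>\<omega>. (Y \<omega>)\<^sup>2) / 2) * cos c" by auto
qed

text \<open>
  The two upper bounds on \<open>\<gamma>\<close> say that \<open>2n/\<gamma>\<close> exceeds \<open>2\<close> and \<open>nk\<close>.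
\<close>

lemma exists_exponent:
  fixes n k \<gamma> :: real
  assumes "0 < \<gamma>" "\<gamma> < n" "\<gamma> < 2 / k" "0 < k" 
  obtains q where "n * k < q" "2 < q" "\<gamma> * q < 2 * n"
proof -
  have "n * k < 2 * n / \<gamma>" "2 < 2 * n / \<gamma>"
    using assms by (simp_all add: field_simps)
  then obtain q where "max (n * k) 2 < q" "q < 2 * n / \<gamma>" using dense[of "max (n * k) 2" "2 * n / \<gamma>"] by auto
  then show ?thesis using assms by (intro that[of q]) (auto simp: field_simps)
qed

locale gaussian_random_field = prob_space M for M :: "'w measure" +
  fixes X :: "'w \<Rightarrow> ('n::finite, 'e::euclidean_space) functional"
    and C :: "real^'n \<Rightarrow> 'e \<Rightarrow>\<^sub>L 'e"
  assumes random_field: "random_field M X" and centred: "centred M X"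
    and gaussian_field: "gaussian_field M X" and covariance_kernel: "covariance_kernel M X C"
begin

definition quadratic_form :: "(real^'n \<Rightarrow> 'e) \<Rightarrow> real" where
  "quadratic_form \<psi> = (LINT x|torus. \<psi> x \<bullet> convolve C \<psi> x)"

lemma X_measurable: "X \<in> M \<rightarrow>\<^sub>M distr_space"
  using random_field by (simp add: random_field_def)

lemmas X_eval = measurable_eval[OF X_measurable]
lemmas X_distribution = value_distribution[OF X_measurable]

lemma
  assumes \<psi>: "\<psi> \<in> test_funs"
  shows X_square_integrable: "integrable M (\<lambda>\<omega>. (X \<omega> \<psi>)\<^sup>2)"
    and X_variance: "expectation (\<lambda>\<omega>. (X \<omega> \<psi>)\<^sup>2) = quadratic_form \<psi>"
    and X_expectation_cos: "expectation (\<lambda>\<omega>. cos (X \<omega> \<psi> + c)) = exp (- quadratic_form \<psi> / 2) * cos c"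
proof -
  have mean: "expectation (\<lambda>\<omega>. X \<omega> \<psi>) = 0" using centred \<psi> by (simp add: centred_def)
  have g: "gaussian_measure (distr M borel (\<lambda>\<omega>. X \<omega> \<psi>))" using gaussian_field \<psi> by (simp add: gaussian_field_def)
  show "integrable M (\<lambda>\<omega>. (X \<omega> \<psi>)\<^sup>2)"
    by (rule centred_gaussian_square_integrable[OF X_eval[OF \<psi>] g mean])
  show v: "expectation (\<lambda>\<omega>. (X \<omega> \<psi>)\<^sup>2) = quadratic_form \<psi>"
  proof -
    have "covariance M (\<lambda>\<omega>. X \<omega> \<psi>) (\<lambda>\<omega>. X \<omega> \<psi>) = quadratic_form \<psi>"
      using covariance_kernel \<psi> unfolding covariance_kernel_def quadratic_form_def by blast
    then show ?thesis by (simp add: covariance_def mean power2_eq_square)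
  qed
  show "expectation (\<lambda>\<omega>. cos (X \<omega> \<psi> + c)) = exp (- quadratic_form \<psi> / 2) * cos c"
    using centred_gaussian_expectation_cos[OF X_eval[OF \<psi>] g mean] by (simp add: v)
qed

text \<open>
  Membership is tested on the sample space only, because \<open>X \<omega>\<close> need not be linear for other \<open>\<omega>\<close>.
\<close>

definition evaluations :: "('w \<Rightarrow> real) set" where
  "evaluations = {L. \<exists>\<psi>\<in>test_funs. \<forall>\<omega>\<in>space M. L \<omega> = X \<omega> \<psi>}"

lemma centred_gaussian_space_evaluations: "centred_gaussian_space M evaluations"
proof unfold_locales
  fix L assume "L \<in> evaluations"
  then obtain \<psi> where \<psi>: "\<psi> \<in> test_funs" and L: "\<And>\<omega>. \<omega> \<in> space M \<Longrightarrow> L \<omega> = X \<omega> \<psi>"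
    by (auto simp: evaluations_def)
  show "L \<in> borel_measurable M"
    using X_eval[OF \<psi>] by (simp add: L cong: measurable_cong)
  show "integrable M (\<lambda>\<omega>. (L \<omega>)\<^sup>2)"
    using X_square_integrable[OF \<psi>] by (simp add: L cong: Bochner_Integration.integrable_cong)
  show "expectation (\<lambda>\<omega>. cos (L \<omega> + c)) = exp (- expectation (\<lambda>\<omega>. (L \<omega>)\<^sup>2) / 2) * cos c" for c
    using X_expectation_cos[OF \<psi>] X_variance[OF \<psi>] by (simp add: L cong: Bochner_Integration.integral_cong)
  fix L' a b assume "L' \<in> evaluations"
  then obtain \<psi>' where \<psi>': "\<psi>' \<in> test_funs" and L': "\<And>\<omega>. \<omega> \<in> space M \<Longrightarrow> L' \<omega> = X \<omega> \<psi>'"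
    by (auto simp: evaluations_def)
  show "(\<lambda>\<omega>. a * L \<omega> + b * L' \<omega>) \<in> evaluations"
  proof -
    have "a * L \<omega> + b * L' \<omega> = X \<omega> (\<lambda>x. a *\<^sub>R \<psi> x + b *\<^sub>R \<psi>' x)" if "\<omega> \<in> space M" for \<omega>
      using distribution_lincomb[OF X_distribution[OF that] \<psi> \<psi>'] by (simp add: L L' that)
    then show ?thesis unfolding evaluations_def using test_funs_lincomb[OF \<psi> \<psi>'] by blast
  qed
qed

text \<open>
  For a cylindrical functional, \<open>\<nabla>f(X) \<bullet> Y\<close> is the evaluation of the copy \<open>Y\<close> at the test function
  \<open>\<delta>G/\<delta>\<xi>\<close>, so integrating over \<open>Y\<close> gives the quadratic form at \<open>\<delta>G/\<delta>\<xi>\<close>.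
\<close>

lemma poincare_quadratic_form:
  assumes \<phi>: "\<And>i. i < m \<Longrightarrow> \<phi> i \<in> test_funs" and f: "smooth_seq m f"
    and bounded: "\<And>T. T \<in> distributions \<Longrightarrow> \<bar>cyl f \<phi> T\<bar> \<le> b"
  shows "ennreal (2 * (expectation (\<lambda>\<omega>. (cyl f \<phi> (X \<omega>))\<^sup>2) - (expectation (\<lambda>\<omega>. cyl f \<phi> (X \<omega>)))\<^sup>2)) \<le>
    ennreal (pi\<^sup>2 / 4) * (\<integral>\<^sup>+\<omega>. ennreal (quadratic_form (cyl_deriv m f \<phi> (X \<omega>))) \<partial>M)"
proof -
  interpret G: centred_gaussian_space M evaluations by (rule centred_gaussian_space_evaluations)
  \<comment> \<open>The functions \<open>\<phi> i\<close> with \<open>i \<ge> m\<close> need not be test functions; \<open>f\<close> does not see them.\<close>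
  define \<phi>' where "\<phi>' i = (if i < m then \<phi> i else (\<lambda>x. 0))" for i
  have \<phi>': "\<phi>' i \<in> test_funs" for i using \<phi> zero_test_fun by (auto simp: \<phi>'_def)
  define x where "x \<omega> i = X \<omega> (\<phi>' i)" for \<omega> i
  have x: "(\<lambda>\<omega>. x \<omega> i) \<in> evaluations" for i
    using \<phi>' by (auto simp: evaluations_def x_def)
  have cyl_eq: "cyl f \<phi> (X \<omega>) = f (x \<omega>)" for \<omega>
    unfolding cyl_def by (rule smooth_seq_cong[OF f]) (simp add: x_def \<phi>'_def)
  have pd_eq: "pderiv_seq i f (\<lambda>j. X \<omega> (\<phi> j)) = pderiv_seq i f (x \<omega>)" if "i < m" for i \<omega>
    by (rule smooth_seq_pderiv_cong[OF f _ that]) (simp add: x_def \<phi>'_def)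
  have test: "cyl_deriv m f \<phi> T \<in> test_funs" for T
    unfolding cyl_deriv_def using \<phi> by (intro test_funs_sum) auto
  have inner: "(\<integral>\<^sup>+\<omega>'. ennreal ((\<Sum>i<m. pderiv_seq i f (x \<omega>) * x \<omega>' i)\<^sup>2) \<partial>M) =
      ennreal (quadratic_form (cyl_deriv m f \<phi> (X \<omega>)))" for \<omega>
  proof -
    have "(\<Sum>i<m. pderiv_seq i f (x \<omega>) * x \<omega>' i) = X \<omega>' (cyl_deriv m f \<phi> (X \<omega>))" if "\<omega>' \<in> space M" for \<omega>'
      unfolding cyl_deriv_def
      by (subst distribution_sum[OF X_distribution[OF that]]) (simp_all add: \<phi> pd_eq x_def \<phi>'_def)
    then have "(\<integral>\<^sup>+\<omega>'. ennreal ((\<Sum>i<m. pderiv_seq i f (x \<omega>) * x \<omega>' i)\<^sup>2) \<partial>M) =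
        (\<integral>\<^sup>+\<omega>'. ennreal ((X \<omega>' (cyl_deriv m f \<phi> (X \<omega>)))\<^sup>2) \<partial>M)"
      by (intro nn_integral_cong) simp
    also have "\<dots> = ennreal (quadratic_form (cyl_deriv m f \<phi> (X \<omega>)))"
      unfolding X_variance[OF test, symmetric] by (rule nn_integral_eq_integral[OF X_square_integrable[OF test]]) simp
    finally show ?thesis .
  qed
  have "\<bar>f (x \<omega>)\<bar> \<le> b" if "\<omega> \<in> space M" for \<omega>
    using bounded[OF X_distribution[OF that]] by (simp add: cyl_eq)
  from G.poincare_inequality[of x, OF x f this]
  show ?thesis by (simp add: cyl_eq inner)
qed

lemma spectral_gap_Lp_norm:
  assumes K: "0 \<le> K" and le: "\<And>\<psi>. \<psi> \<in> test_funs \<Longrightarrow> quadratic_form \<psi> \<le> K * (Lp_norm p \<psi>)\<^sup>2"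
  shows "spectral_gap M X (Lp_norm p)"
  unfolding spectral_gap_def
proof (intro exI[of _ "max 1 (sqrt (pi\<^sup>2 / 8 * K))"] allI impI)
  fix m f and \<phi> :: "nat \<Rightarrow> real^'n \<Rightarrow> 'e"
  assume \<phi>: "\<forall>i<m. \<phi> i \<in> test_funs" and f: "smooth_seq m f"
    and bounded: "\<exists>b. \<forall>T\<in>distributions. \<bar>cyl f \<phi> T\<bar> \<le> b"
    and int: "integrable M (\<lambda>\<omega>. (Lp_norm p (cyl_deriv m f \<phi> (X \<omega>)))\<^sup>2)"
  obtain b where b: "\<And>T. T \<in> distributions \<Longrightarrow> \<bar>cyl f \<phi> T\<bar> \<le> b" using bounded by blast
  define R where "R = (LINT \<omega>|M. (Lp_norm p (cyl_deriv m f \<phi> (X \<omega>)))\<^sup>2)"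
  define S where "S = (LINT \<omega>|M. (cyl f \<phi> (X \<omega>))\<^sup>2)"
  define E where "E = (LINT \<omega>|M. cyl f \<phi> (X \<omega>))"
  have R: "0 \<le> R" by (simp add: R_def)
  have test: "cyl_deriv m f \<phi> T \<in> test_funs" for T
    unfolding cyl_deriv_def using \<phi> by (intro test_funs_sum) auto
  have "ennreal (2 * (S - E\<^sup>2)) \<le> ennreal (pi\<^sup>2 / 4) * (\<integral>\<^sup>+\<omega>. ennreal (quadratic_form (cyl_deriv m f \<phi> (X \<omega>))) \<partial>M)"
    unfolding S_def E_def using poincare_quadratic_form[OF _ f b] \<phi> by blast
  also have "\<dots> \<le> ennreal (pi\<^sup>2 / 4) * (\<integral>\<^sup>+\<omega>. ennreal (K * (Lp_norm p (cyl_deriv m f \<phi> (X \<omega>)))\<^sup>2) \<partial>M)"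
    by (intro mult_left_mono nn_integral_mono ennreal_leI le test) simp
  also have "(\<integral>\<^sup>+\<omega>. ennreal (K * (Lp_norm p (cyl_deriv m f \<phi> (X \<omega>)))\<^sup>2) \<partial>M) = ennreal (K * R)"
    unfolding R_def using K int by (subst nn_integral_eq_integral) auto
  also have "ennreal (pi\<^sup>2 / 4) * ennreal (K * R) = ennreal (pi\<^sup>2 / 4 * (K * R))"
    using K R by (intro ennreal_mult[symmetric]) auto
  finally have "2 * (S - E\<^sup>2) \<le> pi\<^sup>2 / 4 * (K * R)"
    using K R by (subst (asm) ennreal_le_iff) auto
  then have "S \<le> E\<^sup>2 + (pi\<^sup>2 / 8 * K) * R" by simp
  then have "sqrt S \<le> sqrt (E\<^sup>2 + (pi\<^sup>2 / 8 * K) * R)" by simp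
  also have "\<dots> \<le> sqrt (E\<^sup>2) + sqrt ((pi\<^sup>2 / 8 * K) * R)"
    using K R by (intro sqrt_add_le_add_sqrt) auto
  also have "\<dots> = 1 * \<bar>E\<bar> + sqrt (pi\<^sup>2 / 8 * K) * sqrt R" by (simp only: real_sqrt_abs real_sqrt_mult mult_1)
  also have "\<dots> \<le> max 1 (sqrt (pi\<^sup>2 / 8 * K)) * \<bar>E\<bar> + max 1 (sqrt (pi\<^sup>2 / 8 * K)) * sqrt R"
    using R by (intro add_mono mult_right_mono) auto
  finally show "sqrt (LINT \<omega>|M. \<bar>cyl f \<phi> (X \<omega>)\<bar>\<^sup>2) \<le> max 1 (sqrt (pi\<^sup>2 / 8 * K)) *
      (\<bar>LINT \<omega>|M. cyl f \<phi> (X \<omega>)\<bar> + sqrt (LINT \<omega>|M. (Lp_norm p (cyl_deriv m f \<phi> (X \<omega>)))\<^sup>2))"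
    by (simp add: S_def E_def R_def distrib_left)
qed

text \<open>
  The law of \<open>- X\<close> is determined by the same expectations, because \<open>cos (- X \<psi> + c) = cos (X \<psi> - c)\<close>.
\<close>

lemma law_eq_law_negate:
  assumes Y: "Y \<in> M \<rightarrow>\<^sub>M distr_space"
    and cos: "\<And>\<psi> c. \<psi> \<in> test_funs \<Longrightarrow> expectation (\<lambda>\<omega>. cos (Y \<omega> \<psi> + c)) = exp (- quadratic_form \<psi> / 2) * cos c"
  shows "law M Y = law M (\<lambda>\<omega>. negate (X \<omega>))"
proof (rule law_eq_if_cos_eq[OF prob_space_axioms Y])
  show "(\<lambda>\<omega>. negate (X \<omega>)) \<in> M \<rightarrow>\<^sub>M distr_space"
  proof (rule measurable_distr_spaceI)
    show "(\<lambda>\<omega>. negate (X \<omega>) \<phi>) \<in> borel_measurable M" if "\<phi> \<in> test_funs" for \<phi>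
      using X_eval[OF that] that by (simp add: negate_def)
    show "negate (X \<omega>) \<in> distributions" if "\<omega> \<in> space M" for \<omega>
      by (rule negate_distribution[OF X_distribution[OF that]])
  qed
  fix \<psi> :: "real^'n \<Rightarrow> 'e" and c assume \<psi>: "\<psi> \<in> test_funs"
  have "cos (negate (X \<omega>) \<psi> + c) = cos (X \<omega> \<psi> + - c)" for \<omega>
    using cos_minus[of "X \<omega> \<psi> - c"] \<psi> by (simp add: negate_def)
  then have "expectation (\<lambda>\<omega>. cos (negate (X \<omega>) \<psi> + c)) = exp (- quadratic_form \<psi> / 2) * cos c"
    by (simp only: X_expectation_cos[OF \<psi>] cos_minus)
  then show "expectation (\<lambda>\<omega>. cos (Y \<omega> \<psi> + c)) = expectation (\<lambda>\<omega>. cos (negate (X \<omega>) \<psi> + c))"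
    using cos[OF \<psi>] by simp
qed

text \<open>
  For odd \<open>k\<close> the reflected field has the law of \<open>- X\<close> because the
  quadratic form is invariant under reflection; for even \<open>k\<close> this is the symmetry of \<open>X\<close> itself.
\<close>

lemma law_reflect_eq_law_negate:
  assumes C: "periodic C" "\<And>x. C x = C (- x)"
  shows "law M (\<lambda>\<omega>. (reflect ^^ (k mod 2)) (X \<omega>)) = law M (\<lambda>\<omega>. negate (X \<omega>))"
proof (cases "k mod 2 = 0")
  case True
  then show ?thesis using law_eq_law_negate[OF X_measurable X_expectation_cos] by simp
next
  case False
  have "law M (\<lambda>\<omega>. reflect (X \<omega>)) = law M (\<lambda>\<omega>. negate (X \<omega>))"
  proof (rule law_eq_law_negate)
    show "(\<lambda>\<omega>. reflect (X \<omega>)) \<in> M \<rightarrow>\<^sub>M distr_space"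
    proof (rule measurable_distr_spaceI)
      show "(\<lambda>\<omega>. reflect (X \<omega>) \<phi>) \<in> borel_measurable M" if "\<phi> \<in> test_funs" for \<phi>
        using X_eval[OF test_funs_reflect[OF that]] that by (simp add: reflect_def)
      show "reflect (X \<omega>) \<in> distributions" if "\<omega> \<in> space M" for \<omega>
        by (rule reflect_distribution[OF X_distribution[OF that]])
    qed
    fix \<psi> :: "real^'n \<Rightarrow> 'e" and c assume \<psi>: "\<psi> \<in> test_funs"
    have "quadratic_form (\<lambda>x. \<psi> (- x)) = quadratic_form \<psi>"
      using quadratic_form_reflect[OF C] \<psi> by (simp add: quadratic_form_def test_funs_def)
    then show "expectation (\<lambda>\<omega>. cos (reflect (X \<omega>) \<psi> + c)) = exp (- quadratic_form \<psi> / 2) * cos c"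
      using X_expectation_cos[OF test_funs_reflect[OF \<psi>]] \<psi> by (simp add: reflect_def)
  qed
  then show ?thesis using False by (simp add: mod2_eq_if split: if_splits)
qed

end

theorem corollaryA5:
  fixes k :: nat and \<gamma> :: real
    and M :: "'w measure"
    and X :: "'w \<Rightarrow> ('n::finite, 'e::euclidean_space) functional"
    and C :: "real^'n \<Rightarrow> 'e \<Rightarrow>\<^sub>L 'e"
    and Q :: "nat \<Rightarrow> 'e list \<Rightarrow> 'e^'n \<Rightarrow> 'e"
    and P :: "nat \<Rightarrow> 'e list \<Rightarrow> 'e"
    and F F_crit :: "'e \<Rightarrow> 'e^'n \<Rightarrow> 'e"
  assumes "k \<ge> 1"
    and "0 < \<gamma>" and "\<gamma> < min (real CARD('n)) (2 / real k)"
    and "random_field M X" and "centred M X" and "stationary M X" and "gaussian_field M X"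
    and "integrable_kernel C" and "covariance_kernel M X C"
    and "\<And>x. C x = C (- x)"
    and "bdd_above ((\<lambda>x. torus_abs x powr \<gamma> * norm (C x)) ` (- int_lattice))"
    and "\<And>i. i \<le> k \<Longrightarrow> multilinear_sym_lin i (Q i)"
    and "\<And>j. j \<le> 2 * k + 1 \<Longrightarrow> multilinear_sym j (P j)"
    and "\<And>x y. F x y = (\<Sum>i=0..k. Qdiag Q i x y) + (\<Sum>j=0..2*k+1. Pdiag P j x)"
    and "\<And>x y. F_crit x y = Qdiag Q k x y + Pdiag P (2 * k + 1) x"
  shows "(\<exists>q q'. real CARD('n) * real k < q \<and> 1 / q + 1 / q' = 1 \<and> spectral_gap M X (Lp_norm q')) \<and>
    (\<forall>a. law M X = law M (\<lambda>\<omega>. translate a (X \<omega>))) \<and>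
    ((\<exists>x y. F_crit x y \<noteq> 0) \<longrightarrow>
      (\<exists>\<sigma>\<in>{0, 1::nat}.
        law M (\<lambda>\<omega>. (reflect ^^ \<sigma>) (X \<omega>)) = law M (\<lambda>\<omega>. negate (X \<omega>)) \<and>
        ((\<exists>xs y. length xs = k \<and> Q k xs y \<noteq> 0) \<longrightarrow> \<sigma> mod 2 = k mod 2)))"
proof (intro conjI impI)
  have M: "prob_space M" using \<open>random_field M X\<close> by (simp add: random_field_def)
  interpret gaussian_random_field M X C
    using assms(4,5,7,9) M by (simp add: gaussian_random_field_def gaussian_random_field_axioms_def)
  show "\<exists>q q'. real CARD('n) * real k < q \<and> 1 / q + 1 / q' = 1 \<and> spectral_gap M X (Lp_norm q')"
  proof -
    obtain q where q: "real CARD('n) * real k < q" "2 < q" "\<gamma> * q < 2 * real CARD('n)"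
      using exists_exponent[of \<gamma> "real CARD('n)" "real k"] assms(1,2,3) by auto
    define q' where "q' = q / (q - 1)"
    have q': "1 / q + 1 / q' = 1" using q(2) by (simp add: q'_def field_simps)
    obtain K where K: "0 \<le> K"
      and le: "\<And>\<psi>. continuous_on UNIV \<psi> \<Longrightarrow> \<bar>LINT x|torus. \<psi> x \<bullet> convolve C \<psi> x\<bar> \<le> K * (Lp_norm q' \<psi>)\<^sup>2"
      using bilinear_form_le_Lp_norm[OF assms(2,11) q(2,3) q'] by blast
    have "quadratic_form \<psi> \<le> K * (Lp_norm q' \<psi>)\<^sup>2" if "\<psi> \<in> test_funs" for \<psi>
      using le[OF test_fun_continuous[OF that]] unfolding quadratic_form_def by linarith
    from spectral_gap_Lp_norm[OF K this] show ?thesis using q(1) q' by blast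
  qed
  show "\<forall>a. law M X = law M (\<lambda>\<omega>. translate a (X \<omega>))"
    using \<open>stationary M X\<close> by (simp add: stationary_def)
  have "periodic C" using \<open>integrable_kernel C\<close> by (simp add: integrable_kernel_def)
  then have "law M (\<lambda>\<omega>. (reflect ^^ (k mod 2)) (X \<omega>)) = law M (\<lambda>\<omega>. negate (X \<omega>))"
    using assms(10) by (rule law_reflect_eq_law_negate)
  moreover have "k mod 2 \<in> {0, 1}" by auto
  ultimately show "\<exists>\<sigma>\<in>{0, 1}. law M (\<lambda>\<omega>. (reflect ^^ \<sigma>) (X \<omega>)) = law M (\<lambda>\<omega>. negate (X \<omega>)) \<and>
      ((\<exists>xs y. length xs = k \<and> Q k xs y \<noteq> 0) \<longrightarrow> \<sigma> mod 2 = k mod 2)"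
    by (intro bexI[of _ "k mod 2"]) auto
qed

end
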